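(* Let $X$ and $Y$ be Banach spaces, let $T\in L(X,Y)$ be compact and assume that $X$ has a complemented unconditional basic sequence. If $Z$ is an arbitrary separable Banach space, then $T$ factors as $T=T^{(2)}T^{(1)}$ through $X\times Z$, with $T^{(1)}\in L(X,X\times Z)$ and $T^{(2)}\in L(X\times Z,Y)$, such that $T^{(1)}(X)$ is dense in $X\times Z$ and $T^{(2)}$ is compact.
   Context: Banach spaces are over the same field, $\mathbb R$ or $\mathbb C$; $L(X,Y)$ denotes the bounded linear operators. A complemented unconditional basic sequence in $X$ is a sequence $(e_n)_{n=1}^\infty\subset X$ which is an unconditional basis of its closed linear span and whose closed linear span is complemented in $X$ (the range of a bounded projection on $X$). *)

theory Defs
  imports "HOL-Analysis.Analysis"
begin

text \<open>
  The library's type class of Banach spaces is for real scalars only, so the scalar field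
  is made explicit here. The following class describes the fields \<open>\<real>\<close> and \<open>\<complex>\<close> exactly: every
  scalar is real, or there is an imaginary unit that spans the scalars together with 1. (The
  norm need not be pinned down separately: a multiplicative norm on \<open>\<complex>\<close> that extends the
  absolute value of \<open>\<real>\<close> is the usual one.)
\<close>

class real_or_complex = real_normed_field +
  assumes real_or_complex:
    "(\<forall>x. \<exists>r. x = r *\<^sub>R 1) \<or>
     (\<exists>i. i * i = - 1 \<and> (\<forall>x. \<exists>r s. x = r *\<^sub>R 1 + s *\<^sub>R i))"

instance real :: real_or_complex
  by standard auto

instance complex :: real_or_complex
proof
  have "\<forall>x. \<exists>r s. x = r *\<^sub>R 1 + s *\<^sub>R \<i>"
    by (metis complex_eq mult.commute scaleR_conv_of_real mult.right_neutral)
  then show "(\<forall>x::complex. \<exists>r. x = r *\<^sub>R 1) \<or>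
     (\<exists>i::complex. i * i = - 1 \<and> (\<forall>x. \<exists>r s. x = r *\<^sub>R 1 + s *\<^sub>R i))"
    using i_squared by blast
qed

text \<open>
  A Banach space over \<open>'k\<close>: completeness, the norm and the underlying real vector space come
  from the class \<open>banach\<close>; \<open>scale\<close> is the scalar multiplication by elements of \<open>'k\<close>.
\<close>

locale banach_space_over = vector_space scale
  for scale :: "'k::real_or_complex \<Rightarrow> 'a::banach \<Rightarrow> 'a" +
  assumes scale_of_real: "scale (of_real r) x = r *\<^sub>R x"
    and norm_scale: "norm (scale c x) = norm c * norm x"

lemma banach_space_over_real:
  "banach_space_over (scaleR :: real \<Rightarrow> 'a::banach \<Rightarrow> 'a)"
  by unfold_locales (auto simp: algebra_simps)

lemma banach_space_over_complex:
  "banach_space_over ((*) :: complex \<Rightarrow> complex \<Rightarrow> complex)"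
  by unfold_locales (auto simp: algebra_simps norm_mult scaleR_conv_of_real)

text \<open>
  The product carries the norm of the library's product type,
  \<open>norm (x, z) = sqrt ((norm x)\<^sup>2 + (norm z)\<^sup>2)\<close>.
\<close>

lemma banach_space_over_prod:
  assumes "banach_space_over s1" and "banach_space_over s2"
  shows "banach_space_over (module_prod.scale s1 s2)"
proof -
  interpret s1: banach_space_over s1 by fact
  interpret s2: banach_space_over s2 by fact
  interpret vector_space_prod s1 s2 by unfold_locales
  show ?thesis
    by unfold_locales
      (auto simp: scale_def s1.scale_of_real s2.scale_of_real s1.norm_scale s2.norm_scale
        norm_prod_def power_mult_distrib real_sqrt_mult simp flip: distrib_left)
qed

text \<open>
  The library's \<open>bounded_linear\<close> means bounded and linear over the reals.
\<close>

definition bounded_operator ::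
    "('k::real_or_complex \<Rightarrow> 'a::banach \<Rightarrow> 'a) \<Rightarrow> ('k \<Rightarrow> 'b::banach \<Rightarrow> 'b) \<Rightarrow> ('a \<Rightarrow> 'b) \<Rightarrow> bool"
  where "bounded_operator s1 s2 T \<longleftrightarrow> Vector_Spaces.linear s1 s2 T \<and> bounded_linear T"

definition compact_operator ::
    "('k::real_or_complex \<Rightarrow> 'a::banach \<Rightarrow> 'a) \<Rightarrow> ('k \<Rightarrow> 'b::banach \<Rightarrow> 'b) \<Rightarrow> ('a \<Rightarrow> 'b) \<Rightarrow> bool"
  where "compact_operator s1 s2 T \<longleftrightarrow>
    bounded_operator s1 s2 T \<and> compact (closure (T ` cball 0 1))"

definition closed_linear_span ::
    "('k::real_or_complex \<Rightarrow> 'a::banach \<Rightarrow> 'a) \<Rightarrow> 'a set \<Rightarrow> 'a set"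
  where "closed_linear_span s A = closure (module.span s A)"

definition complemented ::
    "('k::real_or_complex \<Rightarrow> 'a::banach \<Rightarrow> 'a) \<Rightarrow> 'a set \<Rightarrow> bool"
  where "complemented s E \<longleftrightarrow>
    (\<exists>P. bounded_operator s s P \<and> P \<circ> P = P \<and> range P = E)"

definition schauder_basis ::
    "('k::real_or_complex \<Rightarrow> 'a::banach \<Rightarrow> 'a) \<Rightarrow> (nat \<Rightarrow> 'a) \<Rightarrow> 'a set \<Rightarrow> bool"
  where "schauder_basis s e E \<longleftrightarrow>
    range e \<subseteq> E \<and> (\<forall>x\<in>E. \<exists>!a. (\<lambda>n. s (a n) (e n)) sums x)"

definition unconditionally_convergent :: "(nat \<Rightarrow> 'a::banach) \<Rightarrow> bool"
  where "unconditionally_convergent f \<longleftrightarrow> (\<forall>\<pi>. bij \<pi> \<longrightarrow> summable (f \<circ> \<pi>))"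

definition unconditional_basis ::
    "('k::real_or_complex \<Rightarrow> 'a::banach \<Rightarrow> 'a) \<Rightarrow> (nat \<Rightarrow> 'a) \<Rightarrow> 'a set \<Rightarrow> bool"
  where "unconditional_basis s e E \<longleftrightarrow>
    schauder_basis s e E \<and>
    (\<forall>x\<in>E. \<forall>a. (\<lambda>n. s (a n) (e n)) sums x \<longrightarrow>
      unconditionally_convergent (\<lambda>n. s (a n) (e n)))"

definition complemented_unconditional_basic_sequence ::
    "('k::real_or_complex \<Rightarrow> 'a::banach \<Rightarrow> 'a) \<Rightarrow> (nat \<Rightarrow> 'a) \<Rightarrow> bool"
  where "complemented_unconditional_basic_sequence s e \<longleftrightarrow>
    unconditional_basis s e (closed_linear_span s (range e)) \<and>
    complemented s (closed_linear_span s (range e))"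

end

theory Submission
  imports Defs "HOL-Library.Disjoint_Sets"
begin

text \<open>
  Suppose first that \<open>d k\<close> is a sequence in \<open>X\<close> with biorthogonal functionals \<open>f k\<close> of uniformly
  bounded norm, that \<open>Q x = (\<Sum>k. f k x \<cdot> d k)\<close> is a bounded projection, and that \<open>norm (T
  (d k)) \<le> 8\<^sup>-\<^sup>k\<close>. The operator \<open>T1\<close> is the identity on the kernel of \<open>Q\<close> and sends \<open>d k\<close> to \<open>(\<mu>
  k \<cdot> d k, \<nu> k \<cdot> z k)\<close>, where every member of a dense sequence in \<open>Z\<close> occurs infinitely often
  among the \<open>z k\<close> and the positive weights \<open>\<mu> k\<close>, \<open>\<nu> k\<close> are so small that the series converge,
  but \<open>\<mu> k / \<nu> k\<close> tends to 0 along the recurrences of each member. Rescaling by \<open>1 / \<nu> k\<close> shows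
  that \<open>(0, z k)\<close> is in the closure of the range, hence all of \<open>{0} \<times> Z\<close> is; subtracting these,
  each \<open>(d k, 0)\<close> and then all of \<open>X \<times> {0}\<close> is there too. So the range is dense. On the other
  hand the first coordinate of \<open>T1 x\<close> already determines \<open>x\<close>, so \<open>T\<close> is recovered from it alone:
  \<open>T2\<close> ignores \<open>Z\<close>, equals \<open>T\<close> on the kernel of \<open>Q\<close> and sends \<open>d k\<close> to \<open>T (d k) / \<mu> k\<close>. The
  smallness of \<open>T (d k)\<close> makes the second part a norm convergent series of rank one operators,
  so \<open>T2\<close> is compact (\<open>dense_compact_factorization\<close>).

  To find the \<open>d k\<close>, let \<open>u k\<close> be the normalized unconditional basis of a complemented subspace.
  Compactness gives a subsequence along which \<open>T (u k)\<close> converges to some \<open>y\<close>. If \<open>y = 0\<close>, a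
  sparse subsequence works, and unconditionality bounds the projection onto its span. If \<open>y \<noteq>
  0\<close>, then \<open>T\<close> is bounded below on combinations of its late terms with nonnegative coefficients,
  and together with unconditionality this makes the coefficients absolutely summable (the
  subsequence is an \<open>\<ell>\<^sup>1\<close> basis); then differences of consecutive terms work, because \<open>T\<close> almost
  annihilates them and the absolute summability makes every series in sight converge
  (\<open>nearly_annihilated_biorthogonal_system\<close>).

  What this needs from the theory of bases is that the coefficient functionals, and all their
  finite partial sums, are uniformly bounded (\<open>normalized_coefficient_functionals\<close>). This is
  Baire category in the form of Zabreiko's lemma: the supremum of the norms of all finite
  partial sums of the expansion is a countably subadditive seminorm.
\<close>

section \<open>Scalars and multipliers\<close>

text \<open>
  The bound comes from the identity \<open>(r + s i) (r - s i) = r\<^sup>2 + s\<^sup>2\<close>: its norm is at most \<open>norm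
  (r + s i) \<cdot> (\<bar>r\<bar> + \<bar>s\<bar>)\<close>, and \<open>(\<bar>r\<bar> + \<bar>s\<bar>)\<^sup>2 \<le> 2 (r\<^sup>2 + s\<^sup>2)\<close>. It lets questions about scalars
  be settled for their two real coordinates.
\<close>

lemma real_or_complex_decomposition:
  obtains i :: "'k::real_or_complex"
  where "norm i \<le> 1"
    and "\<And>x. \<exists>r s. x = of_real r + of_real s * i \<and> \<bar>r\<bar> + \<bar>s\<bar> \<le> 2 * norm x"
proof -
  consider "\<forall>x::'k. \<exists>r. x = r *\<^sub>R 1"
    | i :: 'k where "i * i = - 1" "\<forall>x. \<exists>r s. x = r *\<^sub>R 1 + s *\<^sub>R i"
    using real_or_complex by blast
  then show thesis
  proof cases
    case 1
    have "\<exists>r s. x = of_real r + of_real s * 1 \<and> \<bar>r\<bar> + \<bar>s\<bar> \<le> 2 * norm x" for x :: 'k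
    proof -
      obtain r where "x = r *\<^sub>R 1" using 1 by blast
      then have "x = of_real r + of_real 0 * 1 \<and> \<bar>r\<bar> + \<bar>0\<bar> \<le> 2 * norm x"
        by (simp add: of_real_def)
      then show ?thesis by blast
    qed
    then show thesis by (intro that[of 1]) auto
  next
    case 2
    have "(norm i)\<^sup>2 = 1"
      using 2(1) by (metis norm_minus_cancel norm_mult norm_one power2_eq_square)
    then have i: "norm i = 1"
      using norm_ge_zero[of i] by (metis abs_of_nonneg power2_eq_1_iff abs_neg_one)
    have "\<exists>r s. x = of_real r + of_real s * i \<and> \<bar>r\<bar> + \<bar>s\<bar> \<le> 2 * norm x" for x :: 'k
    proof -
      obtain r s where "x = r *\<^sub>R 1 + s *\<^sub>R i" using 2 by blast
      then have x: "x = of_real r + of_real s * i" by (simp add: scaleR_conv_of_real)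
      let ?t = "\<bar>r\<bar> + \<bar>s\<bar>"
      have "x * (of_real r - of_real s * i) = of_real r * of_real r - of_real s * of_real s * (i * i)"
        unfolding x by (simp add: algebra_simps)
      also have "\<dots> = of_real (r\<^sup>2 + s\<^sup>2)"
        using 2 by (simp add: power2_eq_square)
      finally have *: "norm (of_real (r\<^sup>2 + s\<^sup>2) :: 'k) = norm x * norm (of_real r - of_real s * i)"
        by (metis norm_mult)
      have **: "norm (of_real (r\<^sup>2 + s\<^sup>2) :: 'k) = r\<^sup>2 + s\<^sup>2"
        unfolding norm_of_real by simp
      have "norm (of_real r - of_real s * i) \<le> norm (of_real r :: 'k) + norm (of_real s * i)"
        by (rule norm_triangle_ineq4)
      also have "\<dots> = ?t" by (simp add: norm_mult i)
      finally have "r\<^sup>2 + s\<^sup>2 \<le> norm x * ?t"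
        using * ** mult_left_mono[of _ ?t "norm x"] by (metis norm_ge_zero)
      moreover have "?t\<^sup>2 \<le> 2 * (r\<^sup>2 + s\<^sup>2)"
        using sum_squares_bound[of "\<bar>r\<bar>" "\<bar>s\<bar>"] by (simp add: power2_sum)
      ultimately have "?t * ?t \<le> 2 * norm x * ?t"
        by (simp add: power2_eq_square)
      then have "?t \<le> 2 * norm x"
        using mult_right_le_imp_le[of ?t ?t "2 * norm x"] norm_ge_zero[of x] by linarith
      then show ?thesis using x by blast
    qed
    then show thesis using i by (intro that[of i]) auto
  qed
qed

text \<open>
  The scalar field is complete because its two real coordinates are.
\<close>

lemma summable_scalars_if_summable_norm:
  fixes c :: "nat \<Rightarrow> 'k::real_or_complex"
  assumes "summable (\<lambda>n. norm (c n))"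
  shows "summable c"
proof -
  obtain i :: 'k where "\<And>x. \<exists>r s. x = of_real r + of_real s * i \<and> \<bar>r\<bar> + \<bar>s\<bar> \<le> 2 * norm x"
    using real_or_complex_decomposition by blast
  then have "\<forall>n. \<exists>r s. c n = of_real r + of_real s * i \<and> \<bar>r\<bar> + \<bar>s\<bar> \<le> 2 * norm (c n)"
    by blast
  then obtain r s where rs: "\<And>n. c n = of_real (r n) + of_real (s n) * i"
      "\<And>n. \<bar>r n\<bar> + \<bar>s n\<bar> \<le> 2 * norm (c n)"
    by metis
  have *: "summable (\<lambda>n. 2 * norm (c n))" using assms by (rule summable_mult)
  have "summable r"
    by (rule summable_comparison_test'[OF *]) (use rs(2) in \<open>smt (verit) real_norm_def\<close>)
  moreover have "summable s"
    by (rule summable_comparison_test'[OF *]) (use rs(2) in \<open>smt (verit) real_norm_def\<close>)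
  ultimately show ?thesis
    unfolding rs by (intro summable_add summable_mult2 summable_of_real)
qed

text \<open>
  A sum with multipliers in \<open>[0, 1]\<close> is a convex combination of the subset sums. The offset \<open>y\<close>
  absorbs the element that the induction moves out of the index set.
\<close>

lemma norm_sum_unit_interval_multipliers:
  fixes c :: "'c \<Rightarrow> real"
  assumes "finite F" "\<And>G. G \<subseteq> F \<Longrightarrow> norm (y + (\<Sum>k\<in>G. x k)) \<le> M"
    "\<And>k. k \<in> F \<Longrightarrow> 0 \<le> c k \<and> c k \<le> 1"
  shows "norm (y + (\<Sum>k\<in>F. c k *\<^sub>R (x k :: 'b::real_normed_vector))) \<le> M"
  using assms
proof (induction F arbitrary: y rule: finite_induct)
  case empty
  then show ?case by simp
next
  case (insert j F)
  let ?S = "\<Sum>k\<in>F. c k *\<^sub>R x k"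
  have 0: "norm (y + ?S) \<le> M"
    by (rule insert.IH) (use insert.prems in auto)
  have 1: "norm ((y + x j) + ?S) \<le> M"
  proof (rule insert.IH)
    fix G assume G: "G \<subseteq> F"
    then have "j \<notin> G" "finite G" using insert.hyps finite_subset by auto
    then show "norm (y + x j + sum x G) \<le> M"
      using insert.prems(1)[of "insert j G"] G by (auto simp: add.assoc)
  qed (use insert.prems in auto)
  have c: "0 \<le> c j" "c j \<le> 1" using insert.prems by auto
  have "y + (\<Sum>k\<in>insert j F. c k *\<^sub>R x k) = (1 - c j) *\<^sub>R (y + ?S) + c j *\<^sub>R ((y + x j) + ?S)"
    using insert.hyps by (simp add: algebra_simps)
  also have "norm \<dots> \<le> (1 - c j) * norm (y + ?S) + c j * norm ((y + x j) + ?S)"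
    using c by (intro norm_triangle_le) simp
  also have "\<dots> \<le> (1 - c j) * M + c j * M"
    using 0 1 c by (intro add_mono mult_left_mono) auto
  finally show ?case by (simp add: algebra_simps)
qed

context banach_space_over
begin

lemma bounded_bilinear_scale: "bounded_bilinear scale"
proof
  show "scale (r *\<^sub>R a) b = r *\<^sub>R scale a b" for r a b
    by (simp add: scaleR_conv_of_real flip: scale_scale scale_of_real)
  show "scale a (r *\<^sub>R b) = r *\<^sub>R scale a b" for r a b
    by (simp add: mult.commute flip: scale_of_real)
  show "\<exists>K. \<forall>a b. norm (scale a b) \<le> norm a * norm b * K"
    by (rule exI[of _ 1]) (simp add: norm_scale)
qed (simp_all add: scale_left_distrib scale_right_distrib)

text \<open>
  The factor 8 is crude: each of the two real coordinates of \<open>c k\<close> lies in \<open>[-2, 2]\<close> and is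
  split into its positive and negative part.
\<close>

lemma norm_sum_scalar_multipliers:
  assumes "finite F" and M: "\<And>G. G \<subseteq> F \<Longrightarrow> norm (\<Sum>k\<in>G. x k) \<le> M"
    and c: "\<And>k. k \<in> F \<Longrightarrow> norm (c k) \<le> 1"
  shows "norm (\<Sum>k\<in>F. scale (c k) (x k)) \<le> 8 * M"
proof -
  have M0: "0 \<le> M" using M[of "{}"] by simp
  have real: "norm (\<Sum>k\<in>F. r k *\<^sub>R x k) \<le> 4 * M" if r: "\<And>k. k \<in> F \<Longrightarrow> \<bar>r k\<bar> \<le> 2" for r
  proof -
    let ?p = "\<lambda>k. max (r k) 0 / 2" and ?n = "\<lambda>k. max (- r k) 0 / 2"
    have unit: "norm (\<Sum>k\<in>F. q k *\<^sub>R x k) \<le> M"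
      if "\<And>k. k \<in> F \<Longrightarrow> 0 \<le> q k \<and> q k \<le> 1" for q
      using norm_sum_unit_interval_multipliers[OF assms(1) _ that, of 0 x M] M by simp
    have split: "r k *\<^sub>R x k = 2 *\<^sub>R (?p k *\<^sub>R x k) - 2 *\<^sub>R (?n k *\<^sub>R x k)" for k
      by (cases "r k \<ge> 0") (auto simp: max_def)
    have "norm (\<Sum>k\<in>F. ?p k *\<^sub>R x k) \<le> M"
    proof (rule unit)
      show "0 \<le> ?p k \<and> ?p k \<le> 1" if "k \<in> F" for k
        using r[OF that] by linarith
    qed
    moreover have "norm (\<Sum>k\<in>F. ?n k *\<^sub>R x k) \<le> M"
    proof (rule unit)
      show "0 \<le> ?n k \<and> ?n k \<le> 1" if "k \<in> F" for k
        using r[OF that] by linarith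
    qed
    moreover have "(\<Sum>k\<in>F. r k *\<^sub>R x k) =
        2 *\<^sub>R (\<Sum>k\<in>F. ?p k *\<^sub>R x k) - 2 *\<^sub>R (\<Sum>k\<in>F. ?n k *\<^sub>R x k)"
      unfolding scaleR_sum_right sum_subtractf[symmetric] by (rule sum.cong[OF refl], rule split)
    ultimately show ?thesis
      using norm_triangle_ineq4[of "2 *\<^sub>R (\<Sum>k\<in>F. ?p k *\<^sub>R x k)" "2 *\<^sub>R (\<Sum>k\<in>F. ?n k *\<^sub>R x k)"]
      by (simp only: norm_scaleR abs_numeral)
  qed
  obtain i :: 'k where i: "norm i \<le> 1"
    and "\<And>x. \<exists>r s. x = of_real r + of_real s * i \<and> \<bar>r\<bar> + \<bar>s\<bar> \<le> 2 * norm x"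
    using real_or_complex_decomposition by blast
  then have "\<forall>n. \<exists>r s. c n = of_real r + of_real s * i \<and> \<bar>r\<bar> + \<bar>s\<bar> \<le> 2 * norm (c n)"
    by blast
  then obtain r s where rs: "\<And>n. c n = of_real (r n) + of_real (s n) * i"
      "\<And>n. \<bar>r n\<bar> + \<bar>s n\<bar> \<le> 2 * norm (c n)"
    by metis
  have r: "\<bar>r k\<bar> \<le> 2" and s: "\<bar>s k\<bar> \<le> 2" if "k \<in> F" for k
    using rs(2)[of k] c[OF that] by linarith+
  have "(\<Sum>k\<in>F. scale (c k) (x k)) = (\<Sum>k\<in>F. r k *\<^sub>R x k) + scale i (\<Sum>k\<in>F. s k *\<^sub>R x k)"
    unfolding rs(1) scale_sum_right sum.distrib[symmetric]
    by (intro sum.cong) (simp_all add: scale_left_distrib mult.commute flip: scale_of_real)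
  also have "norm \<dots> \<le> norm (\<Sum>k\<in>F. r k *\<^sub>R x k) + norm i * norm (\<Sum>k\<in>F. s k *\<^sub>R x k)"
    by (metis norm_scale norm_triangle_ineq)
  also have "\<dots> \<le> 4 * M + 1 * (4 * M)"
    using real[OF r] real[OF s] i M0 by (intro add_mono mult_mono) auto
  finally show ?thesis by simp
qed

end

section \<open>Unconditional convergence\<close>

lemma block_permutation_exists:
  fixes m n :: nat
  assumes "G \<subseteq> {m..<n}"
  shows "\<exists>\<sigma>. bij_betw \<sigma> {m..<n} {m..<n} \<and> bij_betw \<sigma> {m..<m + card G} G"
proof -
  have fin: "finite G" using assms finite_subset by blast
  have le: "card G \<le> n - m"
    using card_mono[OF _ assms] by simp
  obtain h1 where h1: "bij_betw h1 {m..<m + card G} G"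
    using finite_same_card_bij[of "{m..<m + card G}" G] fin by auto
  have "card ({m..<n} - G) = n - m - card G"
    using card_Diff_subset[OF fin assms] by simp
  then obtain h2 where h2: "bij_betw h2 {m + card G..<n} ({m..<n} - G)"
    using finite_same_card_bij[of "{m + card G..<n}" "{m..<n} - G"] by auto
  let ?h = "\<lambda>i. if i \<in> {m..<m + card G} then h1 i else h2 i"
  have "bij_betw ?h ({m..<m + card G} \<union> {m + card G..<n}) (G \<union> ({m..<n} - G))"
    using bij_betw_disjoint_Un[OF h1 h2] by auto
  moreover have "{m..<m + card G} \<union> {m + card G..<n} = {m..<n}"
  proof (cases "G = {}")
    case False
    then have "card G > 0" using fin by (simp add: card_gt_0_iff)
    then show ?thesis using le by (intro ivl_disj_un) auto
  qed auto
  moreover have "G \<union> ({m..<n} - G) = {m..<n}" using assms by auto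
  moreover have "bij_betw ?h {m..<m + card G} G"
    using h1 by (rule bij_betw_cong[THEN iffD1, rotated]) auto
  ultimately show ?thesis by metis
qed

lemma bij_if_permutes_blocks:
  fixes N :: "nat \<Rightarrow> nat"
  assumes "strict_mono N" "N 0 = 0"
    and "\<And>j. bij_betw (\<sigma> j) {N j..<N (Suc j)} {N j..<N (Suc j)}"
  obtains \<pi> where "bij \<pi>" "\<And>j i. i \<in> {N j..<N (Suc j)} \<Longrightarrow> \<pi> i = \<sigma> j i"
proof -
  \<comment> \<open>The index of the block that contains a given number.\<close>
  define blk where "blk i = (LEAST j. i < N (Suc j))" for i
  have ex: "i < N (Suc i)" for i
    using strict_mono_imp_increasing[OF assms(1), of "Suc i"] by simp
  have blk: "blk i = j" if "i \<in> {N j..<N (Suc j)}" for i j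
    unfolding blk_def
  proof (rule Least_equality)
    show "i < N (Suc j)" using that by simp
    show "j \<le> k" if "i < N (Suc k)" for k
    proof (rule ccontr)
      assume "\<not> j \<le> k"
      then have "N (Suc k) \<le> N j" using assms(1) by (simp add: strict_mono_less_eq)
      then show False using \<open>i < N (Suc k)\<close> \<open>i \<in> {N j..<N (Suc j)}\<close> by simp
    qed
  qed
  have mem: "i \<in> {N (blk i)..<N (Suc (blk i))}" for i
  proof -
    have "i < N (Suc (blk i))" unfolding blk_def using ex by (rule LeastI)
    moreover have "N (blk i) \<le> i"
    proof (cases "blk i")
      case (Suc k)
      then have "\<not> i < N (Suc k)"
        unfolding blk_def using not_less_Least[of k "\<lambda>j. i < N (Suc j)"] by auto
      then show ?thesis using Suc by simp
    qed (simp add: assms(2))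
    ultimately show ?thesis by simp
  qed
  have disj: "disjoint_family_on (\<lambda>j. {N j..<N (Suc j)}) UNIV"
    unfolding disjoint_family_on_def using blk by (metis disjoint_iff)
  have un: "(\<Union>j. {N j..<N (Suc j)}) = UNIV" using mem by blast
  define \<pi> where "\<pi> i = \<sigma> (blk i) i" for i
  have eq: "\<pi> i = \<sigma> j i" if "i \<in> {N j..<N (Suc j)}" for i j
    using blk[OF that] by (simp add: \<pi>_def)
  have "bij_betw \<pi> {N j..<N (Suc j)} {N j..<N (Suc j)}" for j
    using assms(3)[of j] by (rule bij_betw_cong[THEN iffD1, rotated]) (simp add: eq)
  then have "bij_betw \<pi> (\<Union>j. {N j..<N (Suc j)}) (\<Union>j. {N j..<N (Suc j)})"
    by (intro bij_betw_UNION_disjoint disj)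
  then show thesis using that eq unfolding un by blast
qed

text \<open>
  If the finite sums were unbounded, there would be successive blocks of indices, each
  containing a set whose sum has norm greater than 1. A permutation that lists, inside every
  block, this set first violates the Cauchy criterion.
\<close>

lemma unconditionally_convergent_imp_bounded_finite_sums:
  assumes "unconditionally_convergent f"
  shows "\<exists>M. \<forall>G. finite G \<longrightarrow> norm (sum f G) \<le> M"
proof (rule ccontr)
  assume unb: "\<not> ?thesis"
  have "\<exists>n G. m < n \<and> G \<subseteq> {m..<n} \<and> norm (sum f G) > 1" for m
  proof (rule ccontr)
    assume none: "\<nexists>n G. m < n \<and> G \<subseteq> {m..<n} \<and> norm (sum f G) > 1"
    have "norm (sum f G) \<le> (\<Sum>k<m. norm (f k)) + 1" if G: "finite G" for G
    proof -
      have "sum f G = sum f (G \<inter> {..<m}) + sum f (G - {..<m})"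
        using G by (metis sum.Int_Diff)
      moreover have "norm (sum f (G \<inter> {..<m})) \<le> (\<Sum>k<m. norm (f k))"
        by (rule order_trans[OF norm_sum sum_mono2]) auto
      moreover have "G - {..<m} \<subseteq> {m..<Suc (max m (Max G))}"
      proof
        fix k assume "k \<in> G - {..<m}"
        then show "k \<in> {m..<Suc (max m (Max G))}" using Max_ge[OF G, of k] by auto
      qed
      then have "norm (sum f (G - {..<m})) \<le> 1"
        using none by (metis not_le le_imp_less_Suc max.cobounded1)
      ultimately show ?thesis by (smt (verit) norm_triangle_ineq)
    qed
    then show False using unb by blast
  qed
  then obtain nx B where nx: "\<And>m. m < nx m" "\<And>m. B m \<subseteq> {m..<nx m}"
      "\<And>m. norm (sum f (B m)) > 1"
    by metis
  define N where "N j = (nx ^^ j) 0" for j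
  have N: "N 0 = 0" "N (Suc j) = nx (N j)" for j by (auto simp: N_def)
  have mono: "strict_mono N" unfolding strict_mono_Suc_iff N using nx by simp
  have "\<exists>\<sigma>. bij_betw \<sigma> {N j..<N (Suc j)} {N j..<N (Suc j)} \<and>
      bij_betw \<sigma> {N j..<N j + card (B (N j))} (B (N j))" for j
    unfolding N(2) by (rule block_permutation_exists[OF nx(2)])
  then obtain \<sigma> where \<sigma>: "\<And>j. bij_betw (\<sigma> j) {N j..<N (Suc j)} {N j..<N (Suc j)}"
      "\<And>j. bij_betw (\<sigma> j) {N j..<N j + card (B (N j))} (B (N j))"
    by metis
  obtain \<pi> where \<pi>: "bij \<pi>" "\<And>j i. i \<in> {N j..<N (Suc j)} \<Longrightarrow> \<pi> i = \<sigma> j i"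
    using bij_if_permutes_blocks[OF mono N(1) \<sigma>(1)] by blast
  have "summable (f \<circ> \<pi>)" using assms \<pi>(1) unfolding unconditionally_convergent_def by blast
  then obtain M where M: "\<And>m n. m \<ge> M \<Longrightarrow> norm (sum (f \<circ> \<pi>) {m..<n}) < 1"
    unfolding summable_Cauchy by (metis zero_less_one)
  let ?G = "B (N M)"
  have card: "card ?G \<le> N (Suc M) - N M"
    using card_mono[OF _ nx(2)[of "N M"]] N(2)[of M] by simp
  have "bij_betw \<pi> {N M..<N M + card ?G} ?G"
    by (rule bij_betw_cong[THEN iffD2, OF _ \<sigma>(2)[of M]], rule \<pi>(2)) (use card in auto)
  then have "sum (f \<circ> \<pi>) {N M..<N M + card ?G} = sum f ?G"
    by (simp add: sum.reindex_bij_betw)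
  then show False
    using M[OF strict_mono_imp_increasing[OF mono], of "N M + card ?G"] nx(3)[of "N M"] by simp
qed

section \<open>Zabreiko's lemma and uniform approximation\<close>

lemma norm_funpow_le_if_halving:
  fixes g :: "'a::real_normed_vector \<Rightarrow> 'a"
  assumes "\<And>y. norm (g y) \<le> norm y / 2"
  shows "norm ((g ^^ n) x) \<le> norm x / 2 ^ n"
proof (induction n)
  case (Suc n)
  then show ?case using assms[of "(g ^^ n) x"] by simp
qed simp

text \<open>
  The Baire category theorem in the form that Banach--Steinhaus arguments use.
\<close>

lemma Banach_eq_Union_imp_interior:
  fixes A :: "nat \<Rightarrow> 'a::banach set"
  assumes "\<And>n. closed (A n)" "(\<Union>n. A n) = UNIV"
  shows "\<exists>n y r. r > 0 \<and> ball y r \<subseteq> A n"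
proof (rule ccontr)
  assume no: "\<not> ?thesis"
  have "Met_TC.mcomplete TYPE('a)"
    unfolding Met_TC.mcomplete_def using Cauchy_convergent_iff by (auto simp: convergent_def)
  then have "Met_TC.mtopology interior_of \<Union>(range A) = {}"
  proof (rule Met_TC.metric_Baire_category_alt)
    fix T assume "T \<in> range A"
    then show "closedin Met_TC.mtopology T \<and> Met_TC.mtopology interior_of T = {}"
      using assms(1) no by (auto simp: interior_def) (meson open_contains_ball order_trans)
  qed auto
  then show False using assms(2) by simp
qed

text \<open>
  Zabreiko's lemma. By Baire category the closure of some sublevel set of \<open>p\<close> contains a ball,
  so every \<open>x\<close> is approximated up to \<open>norm x / 2\<close> by some \<open>a\<close> with \<open>p a \<le> K \<cdot> norm x\<close>.
  Approximating the remainder again and again writes \<open>x\<close> as a series to which countable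
  subadditivity applies; this is the successive approximation of the open mapping theorem.
\<close>

theorem countably_subadditive_seminorm_bounded:
  fixes p :: "'a::banach \<Rightarrow> real"
  assumes nonneg: "\<And>x. 0 \<le> p x"
    and scale: "\<And>r x. p (r *\<^sub>R x) = \<bar>r\<bar> * p x"
    and subadd: "\<And>x s. x sums s \<Longrightarrow> summable (\<lambda>n. p (x n)) \<Longrightarrow> p s \<le> (\<Sum>n. p (x n))"
  shows "\<exists>C. \<forall>x. p x \<le> C * norm x"
proof -
  have p0: "p 0 = 0" using scale[of 0 0] by simp
  have add: "p (x + y) \<le> p x + p y" for x y
  proof -
    let ?f = "\<lambda>n. if n = 0 then x else if n = Suc 0 then y else 0"
    have "?f sums (\<Sum>n\<in>{0, Suc 0}. ?f n)" by (rule sums_finite) auto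
    moreover have *: "(\<lambda>n. p (?f n)) sums (\<Sum>n\<in>{0, Suc 0}. p (?f n))"
      by (rule sums_finite) (auto simp: p0)
    ultimately show ?thesis
      using subadd[of ?f "x + y"] sums_unique[OF *] sums_summable[OF *] by simp
  qed
  have diff: "p (x - y) \<le> p x + p y" for x y
    using add[of x "- y"] scale[of "-1" y] by simp
  have "\<exists>n. x \<in> closure {x. p x \<le> real n}" for x
    using real_arch_simple[of "p x"] closure_subset by fastforce
  then have "\<exists>n y r. r > 0 \<and> ball y r \<subseteq> closure {x. p x \<le> real n}"
    by (intro Banach_eq_Union_imp_interior) auto
  then obtain n y r where r: "r > 0" and ball: "ball y r \<subseteq> closure {x. p x \<le> real n}" by blast
  define K where "K = 4 * real n / r"
  have approx: "\<exists>a. p a \<le> K * norm x \<and> norm (x - a) \<le> norm x / 2" for x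
  proof (cases "x = 0")
    case True
    then show ?thesis using p0 by (intro exI[of _ 0]) simp
  next
    case False
    define t where "t = r / (2 * norm x)"
    have t: "t > 0" using False r by (simp add: t_def)
    have tx: "norm (t *\<^sub>R x) = r / 2" using False r by (simp add: t_def)
    have "y \<in> closure {x. p x \<le> real n}" "y + t *\<^sub>R x \<in> closure {x. p x \<le> real n}"
      using ball r tx by (auto simp: dist_norm)
    then obtain a b where a: "p a \<le> n" "norm (a - y) < r / 8" and b: "p b \<le> n" "norm (b - (y + t *\<^sub>R x)) < r / 8"
      unfolding closure_approachable dist_norm using r
      by (metis divide_pos_pos mem_Collect_eq zero_less_numeral)
    let ?a = "(1 / t) *\<^sub>R (b - a)"
    have "p ?a \<le> (1 / t) * (2 * n)"
      using diff[of b a] a b t by (simp add: scale divide_right_mono)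
    also have "\<dots> = K * norm x" using False r by (simp add: t_def K_def field_simps)
    finally have "p ?a \<le> K * norm x" .
    moreover have "x - ?a = (1 / t) *\<^sub>R ((a - y) - (b - (y + t *\<^sub>R x)))"
      using t by (simp add: algebra_simps)
    then have "norm (x - ?a) = (1 / t) * norm ((a - y) - (b - (y + t *\<^sub>R x)))"
      using t by simp
    moreover have "\<dots> \<le> (1 / t) * (r / 4)"
      using norm_triangle_ineq4[of "a - y" "b - (y + t *\<^sub>R x)"] a b t
      by (intro mult_left_mono) auto
    moreover have "(1 / t) * (r / 4) = norm x / 2" using False r by (simp add: t_def field_simps)
    ultimately show ?thesis by (intro exI[of _ ?a]) linarith
  qed
  have "\<exists>A. \<forall>x. p (A x) \<le> K * norm x \<and> norm (x - A x) \<le> norm x / 2"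
    using approx by (intro choice) auto
  then obtain A where A: "\<And>x. p (A x) \<le> K * norm x" "\<And>x. norm (x - A x) \<le> norm x / 2"
    by blast
  have K: "K \<ge> 0" using r by (simp add: K_def)
  \<comment> \<open>The remainder after one approximation; its iterates decay geometrically.\<close>
  define g where "g x = x - A x" for x
  have "p x \<le> (2 * K) * norm x" for x
  proof -
    let ?z = "\<lambda>k. (g ^^ k) x"
    have dec: "norm (?z k) \<le> norm x / 2 ^ k" for k
      by (rule norm_funpow_le_if_halving) (use A in \<open>simp add: g_def\<close>)
    have part: "(\<Sum>k<m. A (?z k)) = x - ?z m" for m
      by (induction m) (auto simp: g_def)
    have geo: "(\<lambda>k. norm x / 2 ^ k) sums (2 * norm x)"
      using sums_mult[OF geometric_sums[of "1/2::real"], of "norm x"]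
      by (simp add: power_one_over field_simps)
    have "?z \<longlonglongrightarrow> 0"
      by (rule Lim_null_comparison[OF _ summable_LIMSEQ_zero[OF sums_summable[OF geo]]])
        (use dec in simp)
    then have "(\<lambda>m. \<Sum>k<m. A (?z k)) \<longlonglongrightarrow> x - 0"
      unfolding part by (intro tendsto_intros)
    then have sums: "(\<lambda>k. A (?z k)) sums x" by (simp add: sums_def)
    have bd: "p (A (?z k)) \<le> K * (norm x / 2 ^ k)" for k
      using A(1)[of "?z k"] mult_left_mono[OF dec K, of k] by linarith
    have geoK: "(\<lambda>k. K * (norm x / 2 ^ k)) sums (K * (2 * norm x))" using geo by (rule sums_mult)
    have summ: "summable (\<lambda>k. p (A (?z k)))"
      by (rule summable_comparison_test'[OF sums_summable[OF geoK]]) (use bd nonneg in simp)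
    have "p x \<le> (\<Sum>k. p (A (?z k)))" by (rule subadd[OF sums summ])
    also have "\<dots> \<le> K * (2 * norm x)"
      using suminf_le[OF bd summ sums_summable[OF geoK]] sums_unique[OF geoK] by simp
    finally show ?thesis by simp
  qed
  then show ?thesis by blast
qed

lemma compact_closure_if_uniformly_approximable:
  fixes S :: "'b \<Rightarrow> 'a::complete_space"
  assumes "\<And>\<epsilon>. \<epsilon> > 0 \<Longrightarrow> \<exists>K. compact K \<and> (\<forall>x\<in>B. \<exists>y\<in>K. dist (S x) y < \<epsilon>)"
  shows "compact (closure (S ` B))"
  unfolding compact_eq_totally_bounded
proof (intro conjI allI impI)
  show "complete (closure (S ` B))" by (simp add: complete_eq_closed)
  fix \<epsilon> :: real assume "\<epsilon> > 0"
  then obtain K where K: "compact K" "\<forall>x\<in>B. \<exists>y\<in>K. dist (S x) y < \<epsilon> / 4"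
    using assms[of "\<epsilon> / 4"] by auto
  then obtain k where k: "finite k" "K \<subseteq> (\<Union>x\<in>k. ball x (\<epsilon> / 4))"
    unfolding compact_eq_totally_bounded using \<open>\<epsilon> > 0\<close> by (meson zero_less_divide_iff zero_less_numeral)
  have "closure (S ` B) \<subseteq> (\<Union>x\<in>k. ball x \<epsilon>)"
  proof
    fix v assume "v \<in> closure (S ` B)"
    then obtain x where x: "x \<in> B" "dist (S x) v < \<epsilon> / 4"
      unfolding closure_approachable using \<open>\<epsilon> > 0\<close> by (metis (no_types, lifting) imageE divide_pos_pos zero_less_numeral)
    obtain y where y: "y \<in> K" "dist (S x) y < \<epsilon> / 4" using K x by blast
    obtain c where c: "c \<in> k" "dist c y < \<epsilon> / 4" using k y by auto
    have "dist c v \<le> dist c y + dist (S x) y + dist (S x) v"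
      by (metis (no_types, opaque_lifting) dist_triangle dist_commute add.assoc add_left_mono order_trans)
    then have "dist c v < \<epsilon>" using x y c \<open>\<epsilon> > 0\<close> by linarith
    then show "v \<in> (\<Union>x\<in>k. ball x \<epsilon>)" using c by auto
  qed
  then show "\<exists>k. finite k \<and> closure (S ` B) \<subseteq> (\<Union>x\<in>k. ball x \<epsilon>)" using k by blast
qed

section \<open>Coefficient functionals of an unconditional basis\<close>

context banach_space_over
begin

text \<open>
  The functionals are the coefficients of \<open>P x\<close>, where \<open>P\<close> is the given projection onto the
  span. Zabreiko's lemma is applied to the supremum \<open>p x\<close> of the norms of the finite partial
  sums of the expansion of \<open>P x\<close>: it is finite by unconditional convergence, and it is countably
  subadditive because for \<open>x = (\<Sum>j. x j)\<close> with \<open>(\<Sum>j. p (x j)) < \<infinity>\<close> the coefficients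
  may be added termwise and the result is, by uniqueness, the expansion of \<open>P x\<close>. Uniform
  smallness of the partial sums over distant index sets, the last conclusion, follows by
  applying the bound to the remainder of the expansion.
\<close>

lemma normalized_coefficient_functionals:
  assumes "complemented_unconditional_basic_sequence scale e"
  obtains u :: "nat \<Rightarrow> 'a" and b :: "nat \<Rightarrow> 'a \<Rightarrow> 'k" and C :: real
  where "\<And>k. norm (u k) = 1"
    and "\<And>k x y. b k (x + y) = b k x + b k y"
    and "\<And>k c x. b k (scale c x) = c * b k x"
    and "\<And>k j. b k (u j) = (if k = j then 1 else 0)"
    and "\<And>F x. finite F \<Longrightarrow> norm (\<Sum>k\<in>F. scale (b k x) (u k)) \<le> C * norm x"
    and "\<And>x \<epsilon>. \<epsilon> > 0 \<Longrightarrow> \<exists>N. \<forall>F. finite F \<and> F \<subseteq> {N..} \<longrightarrow> norm (\<Sum>k\<in>F. scale (b k x) (u k)) < \<epsilon>"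
proof -
  interpret sc: bounded_bilinear scale by (rule bounded_bilinear_scale)
  define E where "E = closed_linear_span scale (range e)"
  have e: "\<And>k. e k \<in> E"
    and uniq: "\<And>x. x \<in> E \<Longrightarrow> \<exists>!a. (\<lambda>n. scale (a n) (e n)) sums x"
    and uncond: "\<And>x a. x \<in> E \<Longrightarrow> (\<lambda>n. scale (a n) (e n)) sums x \<Longrightarrow>
      unconditionally_convergent (\<lambda>n. scale (a n) (e n))"
    using assms unfolding complemented_unconditional_basic_sequence_def unconditional_basis_def
      schauder_basis_def E_def[symmetric] by blast+
  obtain P where P: "bounded_operator scale scale P" "P \<circ> P = P" "range P = E"
    using assms unfolding complemented_unconditional_basic_sequence_def complemented_def
      E_def[symmetric] by blast
  interpret P: bounded_linear P using P(1) by (simp add: bounded_operator_def)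
  have PE: "P x \<in> E" for x using P(3) by blast
  have PPE: "P x = x" if "x \<in> E" for x
    using that P(2,3) by (metis comp_apply rangeE)
  have Pscale: "P (scale c x) = scale c (P x)" for c x
    using P(1) by (simp add: bounded_operator_def Vector_Spaces.linear_iff)
  have "\<forall>x. \<exists>a. (\<lambda>n. scale (a n) (e n)) sums P x" using uniq[OF PE] by blast
  then obtain a where a: "\<And>x. (\<lambda>n. scale (a x n) (e n)) sums P x" by metis
  have aI: "a x = c" if "(\<lambda>n. scale (c n) (e n)) sums P x" for x c
    using uniq[OF PE[of x]] a[of x] that by blast
  have add: "a (x + y) = (\<lambda>n. a x n + a y n)" for x y
    by (rule aI) (use sums_add[OF a[of x] a[of y]] in \<open>simp add: P.add scale_left_distrib\<close>)
  have mult: "a (scale c x) = (\<lambda>n. c * a x n)" for c x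
    by (rule aI) (use bounded_linear.sums[OF sc.bounded_linear_right a[of x], of c] in \<open>simp add: Pscale\<close>)
  have single: "(\<lambda>n. scale (if n = k then 1 else 0) (e n)) sums e k" for k
    using sums_single[of k "\<lambda>n. e n"] by (rule sums_cong[THEN iffD1, rotated]) simp
  have ae: "a (e k) = (\<lambda>n. if n = k then 1 else 0)" for k
    by (rule aI) (use single PPE[OF e] in simp)
  have e0: "e k \<noteq> 0" for k
  proof
    assume k: "e k = 0"
    have "a 0 = (\<lambda>n. 0)" "a 0 = (\<lambda>n. if n = k then 1 else 0)"
      using aI[of "\<lambda>n. 0" 0] ae[of k] k by (auto simp: P.zero)
    then show False by (metis zero_neq_one)
  qed
  define S where "S F x = (\<Sum>k\<in>F. scale (a x k) (e k))" for F x
  define p where "p x = (SUP F\<in>Collect finite. norm (S F x))" for x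
  have bdd: "bdd_above ((\<lambda>F. norm (S F x)) ` Collect finite)" for x
    using unconditionally_convergent_imp_bounded_finite_sums[OF uncond[OF PE a[of x]]]
    unfolding bdd_above_def S_def by auto
  have S_le: "norm (S F x) \<le> p x" if "finite F" for F x
    unfolding p_def by (rule cSUP_upper) (use that bdd in auto)
  have p_le: "p x \<le> M" if "\<And>F. finite F \<Longrightarrow> norm (S F x) \<le> M" for x M
    unfolding p_def by (rule cSUP_least) (use that in auto)
  have p_nonneg: "0 \<le> p x" for x
    using S_le[of "{}" x] by (simp add: S_def)
  have S_lim: "(\<lambda>n. S {..<n} x) \<longlonglongrightarrow> P x" for x
    using a[of x] by (simp add: sums_def S_def)
  have P_le: "norm (P x) \<le> p x" for x
    by (rule LIMSEQ_le_const2[OF tendsto_norm[OF S_lim]]) (use S_le in auto)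
  have S_scaleR: "S F (r *\<^sub>R x) = r *\<^sub>R S F x" for F r x
    by (simp add: S_def mult scale_sum_right flip: scale_of_real)
  have p_scale_le: "p (r *\<^sub>R x) \<le> \<bar>r\<bar> * p x" for r x
    by (rule p_le) (simp add: S_scaleR mult_left_mono S_le)
  have p_scale: "p (r *\<^sub>R x) = \<bar>r\<bar> * p x" for r x
  proof (cases "r = 0")
    case True
    then show ?thesis using p_scale_le[of 0 x] p_nonneg[of 0] by simp
  next
    case False
    have "p x \<le> \<bar>inverse r\<bar> * p (r *\<^sub>R x)"
      using p_scale_le[of "inverse r" "r *\<^sub>R x"] False by simp
    then have "\<bar>r\<bar> * p x \<le> p (r *\<^sub>R x)" using False by (simp add: field_simps)
    then show ?thesis using p_scale_le[of r x] by simp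
  qed
  have subadd: "p s \<le> (\<Sum>j. p (x j))" if x: "x sums s" and px: "summable (\<lambda>j. p (x j))" for x s
  proof -
    define c where "c k = (\<Sum>j. a (x j) k)" for k
    have "summable (\<lambda>j. a (x j) k)" for k
    proof (rule summable_scalars_if_summable_norm, rule summable_comparison_test')
      show "summable (\<lambda>j. p (x j) / norm (e k))" using px by (rule summable_divide)
      show "norm (norm (a (x j) k)) \<le> p (x j) / norm (e k)" for j
        using S_le[of "{k}" "x j"] e0[of k] by (simp add: S_def norm_scale field_simps)
    qed
    then have c: "(\<lambda>j. a (x j) k) sums c k" for k
      unfolding c_def by (rule summable_sums)
    have Sc: "(\<lambda>j. S F (x j)) sums (\<Sum>k\<in>F. scale (c k) (e k))" for F
      unfolding S_def by (intro sums_sum bounded_linear.sums[OF sc.bounded_linear_left c])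
    have Px: "(\<lambda>j. P (x j)) sums P s" using x by (rule P.sums)
    have bound: "norm (S {..<n} (x j) - P (x j)) \<le> 2 * p (x j)" for n j
      using norm_triangle_ineq4[of "S {..<n} (x j)" "P (x j)"] S_le[of "{..<n}" "x j"] P_le[of "x j"]
      by simp
    have px2: "summable (\<lambda>j. 2 * p (x j))" using px by (rule summable_mult)
    have lim0: "(\<lambda>n. norm (S {..<n} (x j) - P (x j))) \<longlonglongrightarrow> 0" for j
      using tendsto_norm[OF tendsto_diff[OF S_lim[of "x j"] tendsto_const[of "P (x j)"]]] by simp
    \<comment> \<open>Tannery's theorem exchanges the limit in \<open>n\<close> with the sum over \<open>j\<close>; the dominating
      terms are \<open>2 * p (x j)\<close>.\<close>
    have "(\<lambda>n. \<Sum>j. norm (S {..<n} (x j) - P (x j))) \<longlonglongrightarrow> (\<Sum>j. 0)"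
      by (rule tannerys_theorem[THEN conjunct2, THEN conjunct2, OF lim0 _ px2])
        (use bound in \<open>auto intro!: always_eventually\<close>)
    then have lim: "(\<lambda>n. \<Sum>j. norm (S {..<n} (x j) - P (x j))) \<longlonglongrightarrow> 0" by simp
    have diff_le: "norm ((\<Sum>k<n. scale (c k) (e k)) - P s) \<le> (\<Sum>j. norm (S {..<n} (x j) - P (x j)))"
      for n
      unfolding sums_unique[OF sums_diff[OF Sc[of "{..<n}"] Px]]
      by (rule summable_norm, rule summable_comparison_test'[OF px2]) (use bound in simp)
    have "(\<lambda>n. (\<Sum>k<n. scale (c k) (e k)) - P s) \<longlonglongrightarrow> 0"
      by (rule Lim_null_comparison[OF always_eventually[OF allI[OF diff_le]] lim])
    then have "(\<lambda>k. scale (c k) (e k)) sums P s"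
      unfolding sums_def by (simp add: LIM_zero_iff)
    then have "a s = c" by (rule aI)
    then have S: "S F s = (\<Sum>j. S F (x j))" for F
      using sums_unique[OF Sc[of F]] by (simp add: S_def)
    show ?thesis
    proof (rule p_le)
      fix F :: "nat set" assume "finite F"
      then show "norm (S F s) \<le> (\<Sum>j. p (x j))"
        unfolding S by (intro norm_suminf_le px S_le)
    qed
  qed
  obtain C where C: "\<And>x. p x \<le> C * norm x"
    using countably_subadditive_seminorm_bounded[of p, OF p_nonneg p_scale subadd] by blast
  have SC: "norm (S F x) \<le> C * norm x" if "finite F" for F x
    using S_le[OF that] C order_trans by blast
  have tail: "\<exists>N. \<forall>F. finite F \<and> F \<subseteq> {N..} \<longrightarrow> norm (S F x) < \<epsilon>" if "\<epsilon> > 0" for x \<epsilon>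
  proof -
    have "(\<lambda>n. C * norm (P x - S {..<n} x)) \<longlonglongrightarrow> C * norm (P x - P x)"
      by (intro tendsto_intros S_lim)
    then have "eventually (\<lambda>n. C * norm (P x - S {..<n} x) < \<epsilon>) sequentially"
      using order_tendstoD(2) \<open>\<epsilon> > 0\<close> by fastforce
    then obtain N where N: "C * norm (P x - S {..<N} x) < \<epsilon>"
      unfolding eventually_sequentially by blast
    have inE: "S {..<n} x = P (S {..<n} x)" for n
      unfolding S_def P.sum Pscale PPE[OF e] by simp
    have "(\<lambda>k. scale (a x k) (e k) - (if k \<in> {..<N} then scale (a x k) (e k) else 0)) sums
        (P x - S {..<N} x)"
      unfolding S_def by (intro sums_diff a sums_If_finite_set) simp
    also have "P x - S {..<N} x = P (P x - S {..<N} x)"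
      unfolding P.diff PPE[OF PE] inE[symmetric] ..
    finally have "(\<lambda>k. scale (if k < N then 0 else a x k) (e k)) sums P (P x - S {..<N} x)"
      by (rule sums_cong[THEN iffD1, rotated]) auto
    then have *: "a (P x - S {..<N} x) = (\<lambda>k. if k < N then 0 else a x k)" by (rule aI)
    have "norm (S F x) < \<epsilon>" if F: "finite F" "F \<subseteq> {N..}" for F
    proof -
      have "S F x = S F (P x - S {..<N} x)"
        unfolding S_def[of F] * using F(2) by (intro sum.cong) auto
      then show ?thesis using SC[OF F(1), of "P x - S {..<N} x"] N by simp
    qed
    then show ?thesis by blast
  qed
  define u where "u k = (1 / norm (e k)) *\<^sub>R e k" for k
  define b where "b k x = of_real (norm (e k)) * a x k" for k x
  have bu: "scale (b k x) (u k) = scale (a x k) (e k)" for k x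
    using e0[of k] by (simp add: b_def u_def mult.commute flip: scale_of_real)
  show thesis
  proof (rule that)
    show "norm (u k) = 1" for k using e0[of k] by (simp add: u_def)
    show "b k (x + y) = b k x + b k y" for k x y by (simp add: b_def add distrib_left)
    show b_scale: "b k (scale c x) = c * b k x" for k c x by (simp add: b_def mult)
    show "b k (u j) = (if k = j then 1 else 0)" for k j
      unfolding u_def scale_of_real[symmetric] b_scale using e0[of j] by (simp add: b_def ae)
    show "norm (\<Sum>k\<in>F. scale (b k x) (u k)) \<le> C * norm x" if "finite F" for F x
      unfolding bu using SC[OF that] by (simp add: S_def)
    show "\<exists>N. \<forall>F. finite F \<and> F \<subseteq> {N..} \<longrightarrow> norm (\<Sum>k\<in>F. scale (b k x) (u k)) < \<epsilon>"
      if "\<epsilon> > 0" for x \<epsilon>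
      unfolding bu using tail[OF that] by (simp add: S_def)
  qed
qed

end

section \<open>A biorthogonal system that a compact operator nearly annihilates\<close>

locale bounded_functionals = banach_space_over scale
  for scale :: "'k::real_or_complex \<Rightarrow> 'a::banach \<Rightarrow> 'a" +
  fixes f :: "nat \<Rightarrow> 'a \<Rightarrow> 'k" and C :: real
  assumes f_add: "f k (x + y) = f k x + f k y"
    and f_scale: "f k (scale c x) = c * f k x"
    and f_bound: "norm (f k x) \<le> C * norm x"

text \<open>
  The last two assumptions say that \<open>x \<mapsto> (\<Sum>k. f k x \<cdot> d k)\<close> is a bounded projection.
\<close>

locale biorthogonal_system = bounded_functionals scale f C
  for scale :: "'k::real_or_complex \<Rightarrow> 'a::banach \<Rightarrow> 'a" and f C +
  fixes d :: "nat \<Rightarrow> 'a"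
  assumes d_bound: "norm (d k) \<le> 2"
    and f_d: "f k (d j) = (if k = j then 1 else 0)"
    and summable_expansion: "summable (\<lambda>k. scale (f k x) (d k))"
    and expansion_bound: "norm (\<Sum>k<n. scale (f k x) (d k)) \<le> C * norm x"

context banach_space_over
begin

lemma strict_mono_choice_if_eventually:
  assumes "\<And>k::nat. eventually (R k) sequentially"
  obtains s where "strict_mono s" "\<And>k. R k (s k)"
proof -
  have "\<exists>s. \<forall>k. R k (s k) \<and> s k < s (Suc k)"
  proof (rule dependent_nat_choice)
    show "\<exists>n. R 0 n" using assms[of 0] eventually_happens'[of sequentially] by auto
    show "\<exists>n. R (Suc k) n \<and> m < n" for m k
      using eventually_happens'[OF _ eventually_conj[OF assms[of "Suc k"] eventually_gt_at_top[of m]]]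
      by auto
  qed
  then show thesis using that by (auto simp: strict_mono_Suc_iff)
qed

text \<open>
  Let \<open>T (u k)\<close> converge to \<open>y\<close> along a subsequence of the normalized basis. If \<open>y = 0\<close>, a
  further subsequence of the basis serves as \<open>d\<close>. If \<open>y \<noteq> 0\<close>, unconditionality allows the
  coefficients \<open>\<beta> k\<close> of \<open>x\<close> to be replaced by \<open>\<bar>\<beta> k\<bar>\<close> at the cost of a constant; as \<open>T (u k)\<close> is
  near \<open>y\<close>, the image under \<open>T\<close> of the new combination has norm at least \<open>(\<Sum>k. \<bar>\<beta> k\<bar>) \<cdot>
  norm y / 2\<close>. Hence the coefficients are absolutely summable, and differences of consecutive
  terms can serve as \<open>d\<close>, with the coefficient of the first term as functional.
\<close>

lemma nearly_annihilated_biorthogonal_system: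
  fixes T :: "'a \<Rightarrow> 'y::real_normed_vector" and \<epsilon> :: "nat \<Rightarrow> real"
  assumes "complemented_unconditional_basic_sequence scale e"
    and "bounded_linear T" and comp: "compact (closure (T ` cball 0 1))"
    and eps: "\<And>k. \<epsilon> k > 0"
  obtains f :: "nat \<Rightarrow> 'a \<Rightarrow> 'k" and C :: real and d :: "nat \<Rightarrow> 'a"
  where "biorthogonal_system scale f C d" and "\<And>k. norm (T (d k)) \<le> \<epsilon> k"
proof -
  interpret T: bounded_linear T by fact
  show thesis
  proof (rule normalized_coefficient_functionals[OF assms(1)])
    fix u :: "nat \<Rightarrow> 'a" and b :: "nat \<Rightarrow> 'a \<Rightarrow> 'k" and C0 :: real
    assume u: "\<And>k. norm (u k) = 1"
      and b_add: "\<And>k x y. b k (x + y) = b k x + b k y"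
      and b_scale: "\<And>k c x. b k (scale c x) = c * b k x"
      and bu: "\<And>k j. b k (u j) = (if k = j then 1 else 0)"
      and bound0: "\<And>F x. finite F \<Longrightarrow> norm (\<Sum>k\<in>F. scale (b k x) (u k)) \<le> C0 * norm x"
      and tail: "\<And>x \<epsilon>. \<epsilon> > 0 \<Longrightarrow>
        \<exists>N. \<forall>F. finite F \<and> F \<subseteq> {N..} \<longrightarrow> norm (\<Sum>k\<in>F. scale (b k x) (u k)) < \<epsilon>"
    define C where "C = max C0 0"
    have bound: "norm (\<Sum>k\<in>F. scale (b k x) (u k)) \<le> C * norm x" if "finite F" for F x
      using bound0[OF that, of x] mult_right_mono[of C0 C "norm x"] by (simp add: C_def)
    have C: "C \<ge> 0" by (simp add: C_def)
    have b_le: "norm (b k x) \<le> C * norm x" for k x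
      using bound[of "{k}" x] by (simp add: norm_scale u)
    have mem: "T (u k) \<in> closure (T ` cball 0 1)" for k
      by (rule subsetD[OF closure_subset imageI]) (simp add: u)
    have "seq_compact (closure (T ` cball 0 1))"
      using comp by (simp add: compact_eq_seq_compact_metric)
    then obtain y r where "y \<in> closure (T ` cball 0 1)" and r: "strict_mono r" and "((\<lambda>k. T (u k)) \<circ> r) \<longlonglongrightarrow> y"
      using seq_compactE[of "closure (T ` cball 0 1)" "\<lambda>k. T (u k)"] mem by metis
    then have y: "(\<lambda>k. T (u (r k))) \<longlonglongrightarrow> y" by (simp add: comp_def)
    show thesis
    proof (cases "y = 0")
      case True
      have "eventually (\<lambda>n. norm (T (u (r n))) < \<epsilon> k) sequentially" for k
        using y True eps[of k] tendsto_norm_zero order_tendstoD(2) by blast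
      from strict_mono_choice_if_eventually[of "\<lambda>k n. norm (T (u (r n))) < \<epsilon> k", OF this]
      obtain s where s: "strict_mono s" "\<And>k. norm (T (u (r (s k)))) < \<epsilon> k" by blast
      define v where "v = r \<circ> s"
      have v: "strict_mono v" unfolding v_def using r s(1) by (rule strict_mono_o)
      have inj: "inj_on v F" for F using v strict_mono_imp_inj_on inj_on_subset by blast
      have sum_v: "(\<Sum>k\<in>F. scale (b (v k) x) (u (v k))) = (\<Sum>k\<in>v ` F. scale (b k x) (u k))" for F x
        by (simp add: sum.reindex[OF inj])
      have "biorthogonal_system scale (\<lambda>k. b (v k)) C (\<lambda>k. u (v k))"
      proof unfold_locales
        show "summable (\<lambda>k. scale (b (v k) x) (u (v k)))" for x
          unfolding summable_Cauchy
        proof (intro allI impI)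
          fix \<epsilon> :: real assume "\<epsilon> > 0"
          from tail[OF this, of x] obtain N where N: "\<And>F. finite F \<Longrightarrow> F \<subseteq> {N..} \<Longrightarrow>
              norm (\<Sum>k\<in>F. scale (b k x) (u k)) < \<epsilon>" by blast
          have "norm (\<Sum>k=m..<n. scale (b (v k) x) (u (v k))) < \<epsilon>" if "m \<ge> N" for m n
            unfolding sum_v
          proof (rule N)
            show "v ` {m..<n} \<subseteq> {N..}"
              using that strict_mono_imp_increasing[OF v] by clarsimp (meson le_trans)
          qed simp
          then show "\<exists>N. \<forall>m\<ge>N. \<forall>n. norm (\<Sum>k=m..<n. scale (b (v k) x) (u (v k))) < \<epsilon>"
            by blast
        qed
        show "norm (\<Sum>k<n. scale (b (v k) x) (u (v k))) \<le> C * norm x" for n x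
          unfolding sum_v by (rule bound) simp
        show "b (v k) (u (v j)) = (if k = j then 1 else 0)" for k j
          using v by (simp add: bu strict_mono_eq)
      qed (simp_all add: u b_add b_scale b_le)
      moreover have "norm (T (u (v k))) \<le> \<epsilon> k" for k
        using s(2)[of k] by (simp add: v_def)
      ultimately show thesis by (rule that)
    next
      case False
      \<comment> \<open>The first bound makes \<open>T (d k)\<close> small for the \<open>k\<close>-th pair of terms, the second keeps
        \<open>T (u k)\<close> away from 0.\<close>
      define \<delta> where "\<delta> k = min (\<epsilon> (k div 2) / 2) (norm y / 2)" for k
      have "\<delta> k > 0" for k using eps False by (simp add: \<delta>_def)
      then have "eventually (\<lambda>n. dist (T (u (r n))) y < \<delta> k) sequentially" for k
        using y tendstoD by blast
      from strict_mono_choice_if_eventually[of "\<lambda>k n. dist (T (u (r n))) y < \<delta> k", OF this]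
      obtain s where s: "strict_mono s" "\<And>k. dist (T (u (r (s k)))) y < \<delta> k" by blast
      define v where "v = r \<circ> s"
      have v: "strict_mono v" unfolding v_def using r s(1) by (rule strict_mono_o)
      have inj: "inj_on v F" for F using v strict_mono_imp_inj_on inj_on_subset by blast
      have Tv: "norm (T (u (v k)) - y) < \<delta> k" for k using s(2)[of k] by (simp add: v_def dist_norm)
      obtain K where K: "K \<ge> 0" "\<And>x. norm (T x) \<le> norm x * K" using T.nonneg_bounded by blast
      define L where "L = 16 * C * K / norm y"
      have L: "L \<ge> 0" using C K by (simp add: L_def)
      have l1: "(\<Sum>k<n. norm (b (v k) x)) \<le> L * norm x" for n x
      proof -
        let ?\<beta> = "\<lambda>k. b (v k) x"
        \<comment> \<open>The combination with coefficients \<open>norm (?\<beta> k)\<close>, written so that the multiplier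
          lemma applies; a vanishing coefficient gets the multiplier \<open>0 / 0 = 0\<close>.\<close>
        define w where "w = (\<Sum>k<n. scale (of_real (norm (?\<beta> k)) / ?\<beta> k) (scale (?\<beta> k) (u (v k))))"
        have w: "w = (\<Sum>k<n. norm (?\<beta> k) *\<^sub>R u (v k))"
          unfolding w_def scale_of_real[symmetric] scale_scale by (intro sum.cong) auto
        have "norm w \<le> 8 * (C * norm x)"
          unfolding w_def
        proof (rule norm_sum_scalar_multipliers)
          fix G assume "G \<subseteq> {..<n}"
          then have "finite G" using finite_subset by blast
          then show "norm (\<Sum>k\<in>G. scale (?\<beta> k) (u (v k))) \<le> C * norm x"
            using bound[of "v ` G" x] by (simp add: sum.reindex[OF inj])
        qed (auto simp: norm_divide)
        then have "norm (T w) \<le> 8 * (C * norm x) * K"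
          using K(2)[of w] mult_right_mono[OF _ K(1)] order_trans by blast
        moreover have "T w = (\<Sum>k<n. norm (?\<beta> k) *\<^sub>R (T (u (v k)) - y)) + (\<Sum>k<n. norm (?\<beta> k)) *\<^sub>R y"
          unfolding w T.sum T.scaleR
          by (simp add: scaleR_diff_right sum_subtractf scaleR_sum_left)
        moreover have "norm (\<Sum>k<n. norm (?\<beta> k) *\<^sub>R (T (u (v k)) - y)) \<le>
            (\<Sum>k<n. norm (?\<beta> k)) * (norm y / 2)"
          unfolding sum_distrib_right
        proof (rule sum_norm_le)
          fix k
          have "norm (T (u (v k)) - y) \<le> norm y / 2" using Tv[of k] by (simp add: \<delta>_def)
          then show "norm (norm (?\<beta> k) *\<^sub>R (T (u (v k)) - y)) \<le> norm (?\<beta> k) * (norm y / 2)"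
            unfolding norm_scaleR abs_norm_cancel by (rule mult_left_mono) simp
        qed
        moreover have "0 \<le> (\<Sum>k<n. norm (?\<beta> k))" by (simp add: sum_nonneg)
        ultimately have "(\<Sum>k<n. norm (?\<beta> k)) * norm y \<le>
            8 * (C * norm x) * K + (\<Sum>k<n. norm (?\<beta> k)) * (norm y / 2)"
          using norm_triangle_ineq4[of "T w" "\<Sum>k<n. norm (?\<beta> k) *\<^sub>R (T (u (v k)) - y)"] by simp
        then show ?thesis using False by (simp add: L_def field_simps)
      qed
      define d where "d k = u (v (2 * k)) - u (v (Suc (2 * k)))" for k
      have d: "norm (d k) \<le> 2" for k
        using norm_triangle_ineq4[of "u (v (2 * k))" "u (v (Suc (2 * k)))"] by (simp add: d_def u)
      have fd: "norm (scale (b (v (2 * k)) x) (d k)) \<le> 2 * norm (b (v (2 * k)) x)" for k x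
        unfolding norm_scale mult.commute[of "norm (b (v (2 * k)) x)"]
        by (rule mult_right_mono[OF d norm_ge_zero])
      have l1_even: "(\<Sum>k<n. norm (b (v (2 * k)) x)) \<le> L * norm x" for n x
      proof -
        have "(\<Sum>k<n. norm (b (v (2 * k)) x)) = (\<Sum>k\<in>(*) 2 ` {..<n}. norm (b (v k) x))"
          by (simp add: sum.reindex inj_on_def)
        also have "\<dots> \<le> (\<Sum>k<2 * n. norm (b (v k) x))"
          by (rule sum_mono2) auto
        finally show ?thesis using l1[of x "2 * n"] by simp
      qed
      have "biorthogonal_system scale (\<lambda>k. b (v (2 * k))) (C + 2 * L) d"
      proof unfold_locales
        show "summable (\<lambda>k. scale (b (v (2 * k)) x) (d k))" for x
        proof (rule summable_comparison_test')
          have "summable (\<lambda>k. norm (b (v (2 * k)) x))"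
            by (rule summableI_nonneg_bounded[OF _ l1_even]) simp
          then show "summable (\<lambda>k. 2 * norm (b (v (2 * k)) x))" by (rule summable_mult)
        qed (use fd in auto)
        show "norm (\<Sum>k<n. scale (b (v (2 * k)) x) (d k)) \<le> (C + 2 * L) * norm x" for n x
        proof -
          have "norm (\<Sum>k<n. scale (b (v (2 * k)) x) (d k)) \<le> (\<Sum>k<n. 2 * norm (b (v (2 * k)) x))"
            by (rule sum_norm_le) (rule fd)
          also have "\<dots> \<le> 2 * (L * norm x)"
            using l1_even[of x n] by (simp flip: sum_distrib_left)
          also have "\<dots> \<le> (C + 2 * L) * norm x" using C by (simp add: distrib_right)
          finally show ?thesis .
        qed
        show "norm (b (v (2 * k)) x) \<le> (C + 2 * L) * norm x" for k x
          using b_le[of "v (2 * k)" x] mult_right_mono[of C "C + 2 * L" "norm x"] L by simp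
        show "b (v (2 * k)) (d j) = (if k = j then 1 else 0)" for k j
        proof -
          have b_diff: "b i (x - z) = b i x - b i z" for i x z
            using b_add[of i "x - z" z] by simp
          have "2 * k \<noteq> Suc (2 * j)" by presburger
          then show ?thesis unfolding d_def b_diff using v by (simp add: bu strict_mono_eq)
        qed
      qed (simp_all add: d b_add b_scale)
      moreover have "norm (T (d k)) \<le> \<epsilon> k" for k
      proof -
        have "T (d k) = (T (u (v (2 * k))) - y) - (T (u (v (Suc (2 * k)))) - y)"
          by (simp add: d_def T.diff)
        then have "norm (T (d k)) \<le> norm (T (u (v (2 * k))) - y) + norm (T (u (v (Suc (2 * k)))) - y)"
          by (simp only: norm_triangle_ineq4)
        then show ?thesis using Tv[of "2 * k"] Tv[of "Suc (2 * k)"] by (simp add: \<delta>_def)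
      qed
      ultimately show thesis by (rule that)
    qed
  qed
qed

end

section \<open>Bounded operators\<close>

lemma bounded_operator_iff:
  assumes "banach_space_over s1" "banach_space_over s2"
  shows "bounded_operator s1 s2 T \<longleftrightarrow> bounded_linear T \<and> (\<forall>c x. T (s1 c x) = s2 c (T x))"
proof -
  have "vector_space s1" "vector_space s2" using assms by (simp_all add: banach_space_over_def)
  then show ?thesis
    unfolding bounded_operator_def Vector_Spaces.linear_iff
    by (auto simp: linear_add[OF bounded_linear.linear])
qed

lemma bounded_operator_suminf:
  assumes s: "banach_space_over s1" "banach_space_over s2"
    and g: "\<And>k::nat. bounded_operator s1 s2 (g k)" and summ: "\<And>x. summable (\<lambda>k. g k x)"
    and bound: "\<And>n x. norm (\<Sum>k<n. g k x) \<le> K * norm x"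
  shows "bounded_operator s1 s2 (\<lambda>x. \<Sum>k. g k x)"
proof -
  have g: "bounded_linear (g k)" "g k (s1 c x) = s2 c (g k x)" for k c x
    using g s by (auto simp: bounded_operator_iff)
  have "bounded_linear (\<lambda>x. \<Sum>k. g k x)"
  proof (rule bounded_linear_intro)
    show "(\<Sum>k. g k (x + y)) = (\<Sum>k. g k x) + (\<Sum>k. g k y)" for x y
      by (simp add: g(1)[THEN bounded_linear.linear, THEN linear_add] suminf_add summ)
    show "(\<Sum>k. g k (r *\<^sub>R x)) = r *\<^sub>R (\<Sum>k. g k x)" for r x
      by (simp add: g(1)[THEN bounded_linear.linear, THEN linear_scale] suminf_scaleR_right summ)
    show "norm (\<Sum>k. g k x) \<le> norm x * K" for x
      by (rule LIMSEQ_le_const2[OF tendsto_norm[OF summable_LIMSEQ[OF summ]]])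
        (use bound in \<open>auto simp: mult.commute\<close>)
  qed
  moreover have "(\<Sum>k. g k (s1 c x)) = s2 c (\<Sum>k. g k x)" for c x
    unfolding g(2)
    using bounded_linear.suminf[OF bounded_bilinear.bounded_linear_right[OF
          banach_space_over.bounded_bilinear_scale[OF s(2)]] summ, of c x] by simp
  ultimately show ?thesis using s by (simp add: bounded_operator_iff)
qed

lemma bounded_operator_compose:
  assumes "bounded_operator s2 s3 S" "bounded_operator s1 s2 T"
  shows "bounded_operator s1 s3 (\<lambda>x. S (T x))"
  using assms unfolding bounded_operator_def Vector_Spaces.linear_iff
  by (auto intro: bounded_linear_compose)

lemma bounded_operator_add:
  assumes "bounded_operator s1 s2 S" "bounded_operator s1 s2 T"
  shows "bounded_operator s1 s2 (\<lambda>x. S x + T x)"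
  using assms unfolding bounded_operator_def Vector_Spaces.linear_iff
  by (auto intro: bounded_linear_add simp: vector_space.vector_space_assms)

lemma bounded_operator_diff:
  assumes "bounded_operator s1 s2 S" "bounded_operator s1 s2 T"
  shows "bounded_operator s1 s2 (\<lambda>x. S x - T x)"
  using assms unfolding bounded_operator_def Vector_Spaces.linear_iff
  by (auto intro: bounded_linear_sub simp: module.scale_right_diff_distrib vector_space_def module_def)

lemma bounded_operator_id:
  assumes "banach_space_over s"
  shows "bounded_operator s s (\<lambda>x. x)"
  using assms by (simp add: bounded_operator_iff bounded_linear_ident)

lemma prod_scale_Pair:
  assumes "banach_space_over s1" "banach_space_over s2"
  shows "module_prod.scale s1 s2 c (x, z) = (s1 c x, s2 c z)"
proof -
  interpret s1: banach_space_over s1 by fact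
  interpret s2: banach_space_over s2 by fact
  interpret vector_space_prod s1 s2 by unfold_locales
  show ?thesis by (rule scale_prod)
qed

lemma bounded_operator_Pair:
  assumes s: "banach_space_over s1" "banach_space_over s2" "banach_space_over s3"
    and "bounded_operator s1 s2 S" "bounded_operator s1 s3 T"
  shows "bounded_operator s1 (module_prod.scale s2 s3) (\<lambda>x. (S x, T x))"
  using assms banach_space_over_prod[OF s(2,3)]
  by (auto simp: bounded_operator_iff prod_scale_Pair bounded_linear_Pair)

lemma bounded_operator_fst:
  assumes s: "banach_space_over s1" "banach_space_over s2"
  shows "bounded_operator (module_prod.scale s1 s2) s1 fst"
  using assms banach_space_over_prod[OF s]
  by (auto simp: bounded_operator_iff prod_scale_Pair bounded_linear_fst)

lemma subspace_closure:
  fixes S :: "'a::real_normed_vector set"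
  assumes "subspace S"
  shows "subspace (closure S)"
proof (rule subspaceI)
  show "0 \<in> closure S" using subspace_0[OF assms] closure_subset by blast
  show "x + y \<in> closure S" if xy: "x \<in> closure S" "y \<in> closure S" for x y
  proof -
    obtain f g where "\<And>n. f n \<in> S" "f \<longlonglongrightarrow> x" "\<And>n. g n \<in> S" "g \<longlonglongrightarrow> y"
      using xy by (auto simp: closure_sequential)
    then show ?thesis
      unfolding closure_sequential
      by (intro exI[of _ "\<lambda>n. f n + g n"]) (auto intro: tendsto_add subspace_add[OF assms])
  qed
  show "r *\<^sub>R x \<in> closure S" if x: "x \<in> closure S" for r x
  proof -
    obtain f where "\<And>n. f n \<in> S" "f \<longlonglongrightarrow> x" using x by (auto simp: closure_sequential)
    then show ?thesis
      unfolding closure_sequential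
      by (intro exI[of _ "\<lambda>n. r *\<^sub>R f n"]) (auto intro: tendsto_scaleR subspace_scale[OF assms])
  qed
qed

section \<open>Operators given by series of functionals\<close>

context bounded_functionals
begin

lemma f_bound_nonneg: "0 \<le> C * norm (x :: 'a)"
  by (rule order_trans[OF norm_ge_zero f_bound])

lemma bounded_operator_rank_one:
  assumes "banach_space_over s"
  shows "bounded_operator scale s (\<lambda>x. s (f k x) v)"
proof -
  interpret s: banach_space_over s by fact
  have "bounded_linear (\<lambda>x. s (f k x) v)"
  proof (rule bounded_linear_intro)
    show "s (f k (x + y)) v = s (f k x) v + s (f k y) v" for x y
      by (simp add: f_add s.scale_left_distrib)
    show "s (f k (r *\<^sub>R x)) v = r *\<^sub>R s (f k x) v" for r x
      by (simp add: f_scale flip: scale_of_real s.scale_of_real)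
    show "norm (s (f k x) v) \<le> norm x * (C * norm v)" for x
      using mult_right_mono[OF f_bound[of k x], of "norm v"] by (simp add: s.norm_scale mult_ac)
  qed
  then show ?thesis
    using banach_space_over_axioms assms by (simp add: bounded_operator_iff f_scale)
qed

definition functional_series :: "('k \<Rightarrow> 'b \<Rightarrow> 'b) \<Rightarrow> (nat \<Rightarrow> 'b) \<Rightarrow> 'a \<Rightarrow> 'b::banach"
  where "functional_series s v x = (\<Sum>k. s (f k x) (v k))"

context
  fixes s :: "'k \<Rightarrow> 'b::banach \<Rightarrow> 'b" and v :: "nat \<Rightarrow> 'b"
  assumes s: "banach_space_over s" and v: "summable (\<lambda>k. norm (v k))"
begin

lemma norm_functional_series_term: "norm (s (f k x) (v k)) \<le> C * norm x * norm (v k)"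
  using mult_right_mono[OF f_bound[of k x], of "norm (v k)"]
  by (simp add: banach_space_over.norm_scale[OF s])

lemma summable_functional_series: "summable (\<lambda>k. s (f k x) (v k))"
  by (rule summable_comparison_test'[OF summable_mult[OF v, of "C * norm x"] norm_functional_series_term])

lemma norm_functional_series_tail:
  "norm (functional_series s v x - (\<Sum>k<n. s (f k x) (v k))) \<le> C * norm x * (\<Sum>k. norm (v (k + n)))"
proof -
  have v': "summable (\<lambda>k. norm (v (k + n)))" using v by (simp add: summable_iff_shift[of "\<lambda>k. norm (v k)"])
  have "functional_series s v x - (\<Sum>k<n. s (f k x) (v k)) = (\<Sum>k. s (f (k + n) x) (v (k + n)))"
    unfolding functional_series_def using suminf_minus_initial_segment[OF summable_functional_series[of x], of n] by simp
  also have "norm \<dots> \<le> (\<Sum>k. C * norm x * norm (v (k + n)))"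
    by (rule norm_suminf_le[OF norm_functional_series_term summable_mult[OF v']])
  finally show ?thesis by (simp add: suminf_mult[OF v'])
qed

lemma bounded_operator_functional_series: "bounded_operator scale s (functional_series s v)"
  unfolding functional_series_def
proof (rule bounded_operator_suminf[OF banach_space_over_axioms s])
  show "norm (\<Sum>k<n. s (f k x) (v k)) \<le> (C * (\<Sum>k. norm (v k))) * norm x" for n x
  proof -
    have "norm (\<Sum>k<n. s (f k x) (v k)) \<le> (\<Sum>k<n. C * norm x * norm (v k))"
      by (rule sum_norm_le) (rule norm_functional_series_term)
    also have "\<dots> = C * norm x * (\<Sum>k<n. norm (v k))" by (rule sum_distrib_left[symmetric])
    also have "\<dots> \<le> C * norm x * (\<Sum>k. norm (v k))"
      by (intro mult_left_mono sum_le_suminf v f_bound_nonneg) auto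
    finally show ?thesis by (simp add: mult_ac)
  qed
qed (rule bounded_operator_rank_one[OF s] summable_functional_series)+

end

text \<open>
  Replacing the series by a finite partial sum changes the operator by little on the unit ball,
  and what remains is \<open>T\<close> composed with a bounded operator: the terms of the series have the
  values \<open>T (d k)\<close>, so that \<open>T\<close> can be factored out.
\<close>

lemma compact_operator_add_functional_series:
  assumes s': "banach_space_over s'" and s: "banach_space_over s"
    and T: "compact_operator scale s T" and B: "bounded_operator s' scale B"
    and L: "bounded_operator s' scale L" and Td: "summable (\<lambda>k. norm (T (d k)))"
  shows "compact_operator s' s (\<lambda>x. T (B x) + functional_series s (\<lambda>k. T (d k)) (L x))" (is "compact_operator s' s ?S")
proof -
  have T': "bounded_operator scale s T" using T by (simp add: compact_operator_def)
  interpret T: bounded_linear T using T' by (simp add: bounded_operator_def)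
  interpret L: bounded_linear L using L by (simp add: bounded_operator_def)
  have T_scale: "T (scale c x) = s c (T x)" for c x
    using T' banach_space_over_axioms s by (simp add: bounded_operator_iff)
  have S: "bounded_operator s' s ?S"
    by (intro bounded_operator_add bounded_operator_compose[OF T' B]
        bounded_operator_compose[OF bounded_operator_functional_series[OF s Td] L])
  have "compact (closure (?S ` cball 0 1))"
  proof (rule compact_closure_if_uniformly_approximable)
    fix \<epsilon> :: real assume "\<epsilon> > 0"
    obtain M where M: "M \<ge> 0" "\<And>x. norm (L x) \<le> norm x * M" using L.nonneg_bounded by blast
    define M' where "M' = \<bar>C\<bar> * M + 1"
    have M': "M' > 0" using M by (simp add: M'_def add_nonneg_pos)
    obtain n where n: "norm (\<Sum>k. norm (T (d (k + n)))) < \<epsilon> / M'"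
      using suminf_exist_split[OF _ Td, of "\<epsilon> / M'"] \<open>\<epsilon> > 0\<close> M' by auto
    define B' where "B' x = B x + (\<Sum>k<n. scale (f k (L x)) (d k))" for x
    have "bounded_operator s' scale (\<lambda>x. \<Sum>k<n. scale (f k (L x)) (d k))"
    proof (induction n)
      case 0
      then show ?case
        using s' banach_space_over_axioms by (simp add: bounded_operator_iff)
    next
      case (Suc n)
      show ?case
        unfolding sum.lessThan_Suc
        by (intro bounded_operator_add Suc
            bounded_operator_compose[OF bounded_operator_rank_one[OF banach_space_over_axioms] L])
    qed
    then have "bounded_operator s' scale B'" unfolding B'_def by (intro bounded_operator_add B)
    then interpret B': bounded_linear B' by (simp add: bounded_operator_def)
    obtain N where N: "N > 0" "\<And>x. norm (B' x) \<le> norm x * N" using B'.pos_bounded by blast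
    define K where "K = (\<lambda>y. N *\<^sub>R y) ` closure (T ` cball 0 1)"
    have "compact K"
      unfolding K_def using T by (intro compact_scaling) (simp add: compact_operator_def)
    moreover have "\<exists>y\<in>K. dist (?S x) y < \<epsilon>" if x: "x \<in> cball 0 1" for x
    proof
      have "norm (B' x) \<le> N"
        using order_trans[OF N(2)[of x] mult_right_mono[of "norm x" 1 N]] N(1) x by simp
      then have "norm ((1 / N) *\<^sub>R B' x) \<le> 1" using N(1) by (simp add: field_simps)
      then have "T ((1 / N) *\<^sub>R B' x) \<in> closure (T ` cball 0 1)"
        by (intro subsetD[OF closure_subset imageI]) simp
      then have "N *\<^sub>R T ((1 / N) *\<^sub>R B' x) \<in> K" unfolding K_def by blast
      then show "T (B' x) \<in> K" using N(1) by (simp add: T.scaleR)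
      have "T (B' x) = T (B x) + (\<Sum>k<n. s (f k (L x)) (T (d k)))"
        unfolding B'_def T.add T.sum T_scale ..
      then have "dist (?S x) (T (B' x)) =
          norm (functional_series s (\<lambda>k. T (d k)) (L x) - (\<Sum>k<n. s (f k (L x)) (T (d k))))"
        by (simp add: dist_norm)
      also have "\<dots> \<le> C * norm (L x) * (\<Sum>k. norm (T (d (k + n))))"
        by (rule norm_functional_series_tail[OF s Td])
      also have "\<dots> \<le> M' * (\<Sum>k. norm (T (d (k + n))))"
      proof (rule mult_right_mono)
        have "C * norm (L x) \<le> \<bar>C\<bar> * norm (L x)" by (rule mult_right_mono) auto
        also have "\<dots> \<le> \<bar>C\<bar> * M"
          using order_trans[OF M(2)[of x] mult_right_mono[of "norm x" 1 M]] M(1) x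
          by (intro mult_left_mono) auto
        finally show "C * norm (L x) \<le> M'" by (simp add: M'_def)
        have "summable (\<lambda>k. norm (T (d (k + n))))"
          using Td by (simp add: summable_iff_shift[of "\<lambda>k. norm (T (d k))"])
        then show "0 \<le> (\<Sum>k. norm (T (d (k + n))))" by (rule suminf_nonneg) simp
      qed
      also have "\<dots> < \<epsilon>"
        using order_le_less_trans[OF abs_ge_self n[unfolded real_norm_def]] M' by (simp add: field_simps)
      finally show "dist (?S x) (T (B' x)) < \<epsilon>" .
    qed
    ultimately show "\<exists>K. compact K \<and> (\<forall>x\<in>cball 0 1. \<exists>y\<in>K. dist (?S x) y < \<epsilon>)" by blast
  qed
  then show ?thesis using S by (simp add: compact_operator_def)
qed

end


context biorthogonal_system
begin

abbreviation projection :: "'a \<Rightarrow> 'a"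
  where "projection \<equiv> functional_series scale d"

lemma bounded_operator_projection: "bounded_operator scale scale projection"
  unfolding functional_series_def
  by (rule bounded_operator_suminf[OF banach_space_over_axioms banach_space_over_axioms
        bounded_operator_rank_one[OF banach_space_over_axioms] summable_expansion expansion_bound])

lemma bounded_linear_f: "bounded_linear (f j)"
proof (rule bounded_linear_intro)
  show "f j (r *\<^sub>R x) = r *\<^sub>R f j x" for r x
    by (simp add: f_scale scaleR_conv_of_real flip: scale_of_real)
  show "norm (f j x) \<le> norm x * C" for x
    using f_bound[of j x] by (simp add: mult.commute)
qed (rule f_add)

lemma f_of_series:
  assumes "summable (\<lambda>k. scale (c k) (d k))"
  shows "f j (\<Sum>k. scale (c k) (d k)) = c j"
proof -
  have "f j (\<Sum>k. scale (c k) (d k)) = (\<Sum>k. f j (scale (c k) (d k)))"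
    by (rule bounded_linear.suminf[OF bounded_linear_f assms])
  also have "\<dots> = (\<Sum>k\<in>{j}. f j (scale (c k) (d k)))"
    by (rule suminf_finite) (auto simp: f_scale f_d)
  finally show ?thesis by (simp add: f_scale f_d)
qed

lemma functional_series_d:
  assumes "banach_space_over s"
  shows "functional_series s v (scale c (d k)) = s c (v k)"
proof -
  interpret s: banach_space_over s by fact
  have "functional_series s v (scale c (d k)) = (\<Sum>j\<in>{k}. s (f j (scale c (d k))) (v j))"
    unfolding functional_series_def by (rule suminf_finite) (auto simp: f_scale f_d)
  then show ?thesis by (simp add: f_scale f_d)
qed

end

section \<open>The factorization\<close>

text \<open>
  Here \<open>\<mu> k = 4\<^sup>-\<^sup>k\<close> and \<open>\<nu> k = 2\<^sup>-\<^sup>k / (1 + norm (z k))\<close>, so \<open>\<nu> k \<cdot> z k\<close> is summable, \<open>T (d k)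
  / \<mu> k\<close> is summable thanks to the bound \<open>8\<^sup>-\<^sup>k\<close>, and \<open>\<mu> k / \<nu> k = 2\<^sup>-\<^sup>k (1 + norm (z k))\<close> tends
  to 0 along the \<open>k\<close> for which \<open>z k\<close> is a fixed member of the dense sequence.
\<close>

theorem dense_compact_factorization:
  fixes sX :: "'k::real_or_complex \<Rightarrow> 'x::banach \<Rightarrow> 'x"
    and sY :: "'k \<Rightarrow> 'y::banach \<Rightarrow> 'y"
    and sZ :: "'k \<Rightarrow> 'z::banach \<Rightarrow> 'z"
    and w :: "nat \<Rightarrow> 'z"
  assumes sYZ: "banach_space_over sY" "banach_space_over sZ"
    and T: "compact_operator sX sY T"
    and sys: "biorthogonal_system sX f C d" and Td: "\<And>k. norm (T (d k)) \<le> (1 / 8) ^ k"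
    and w: "closure (range w) = UNIV"
  shows "\<exists>(T1 :: 'x \<Rightarrow> 'x \<times> 'z) (T2 :: 'x \<times> 'z \<Rightarrow> 'y).
           bounded_operator sX (module_prod.scale sX sZ) T1 \<and>
           compact_operator (module_prod.scale sX sZ) sY T2 \<and>
           T = T2 \<circ> T1 \<and>
           closure (range T1) = UNIV"
proof -
  interpret biorthogonal_system sX f C d by fact
  interpret Y: banach_space_over sY by fact
  interpret Z: banach_space_over sZ by fact
  have sX: "banach_space_over sX" by (rule banach_space_over_axioms)
  have T_op: "bounded_operator sX sY T" using T by (simp add: compact_operator_def)
  interpret T: bounded_linear T using T_op by (simp add: bounded_operator_def)
  have T_scale: "T (sX c x) = sY c (T x)" for c x
    using T_op sX sYZ by (simp add: bounded_operator_iff)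

  \<comment> \<open>The first component of the decoded index takes every value infinitely often.\<close>
  define z where "z k = w (fst (prod_decode k))" for k
  define \<mu> where "\<mu> k = (1 / 4 :: real) ^ k" for k :: nat
  define \<nu> where "\<nu> k = (1 / 2 :: real) ^ k / (1 + norm (z k))" for k
  have \<mu>: "\<mu> k > 0" for k by (simp add: \<mu>_def)
  have z1: "0 < 1 + norm v" for v :: 'z using norm_ge_zero[of v] by linarith
  have \<nu>: "\<nu> k > 0" for k by (simp add: \<nu>_def z1)

  let ?d = "\<lambda>k. \<mu> k *\<^sub>R d k" and ?z = "\<lambda>k. \<nu> k *\<^sub>R z k" and ?y = "\<lambda>k. T ((1 / \<mu> k) *\<^sub>R d k)"
  have sum_d: "summable (\<lambda>k. norm (?d k))"
  proof (rule summable_comparison_test')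
    show "summable (\<lambda>k. (1 / 4 :: real) ^ k * 2)" by (intro summable_mult2 summable_geometric) simp
    show "norm (norm (?d k)) \<le> (1 / 4) ^ k * 2" for k
      using d_bound[of k] by (simp add: \<mu>_def)
  qed
  have sum_z: "summable (\<lambda>k. norm (?z k))"
  proof (rule summable_comparison_test')
    show "summable (\<lambda>k. (1 / 2 :: real) ^ k)" by (intro summable_geometric) simp
    show "norm (norm (?z k)) \<le> (1 / 2) ^ k" for k
    proof -
      have "norm (z k) / (1 + norm (z k)) \<le> 1" using z1[of "z k"] by simp
      then have "(1 / 2) ^ k * (norm (z k) / (1 + norm (z k))) \<le> (1 / 2) ^ k * (1 :: real)"
        by (intro mult_left_mono) auto
      then show ?thesis using \<nu>[of k] by (simp add: \<nu>_def)
    qed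
  qed
  have sum_y: "summable (\<lambda>k. norm (?y k))"
  proof (rule summable_comparison_test')
    show "summable (\<lambda>k. (1 / 2 :: real) ^ k)" by (intro summable_geometric) simp
    show "norm (norm (?y k)) \<le> (1 / 2) ^ k" for k
    proof -
      have "norm (?y k) = 4 ^ k * norm (T (d k))"
        by (simp add: T.scaleR \<mu>_def power_one_over)
      also have "\<dots> \<le> 4 ^ k * (1 / 8) ^ k" by (rule mult_left_mono[OF Td]) simp
      also have "\<dots> = (1 / 2) ^ k" by (simp flip: power_mult_distrib)
      finally show ?thesis by simp
    qed
  qed

  let ?R = "\<lambda>x. x - projection x"
  let ?D = "functional_series sX ?d" and ?N = "functional_series sZ ?z"
  define T1 where "T1 x = (?R x + ?D x, ?N x)" for x
  define T2 where "T2 p = T (?R (fst p)) + functional_series sY ?y (fst p)" for p :: "'x \<times> 'z"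

  have R_op: "bounded_operator sX sX ?R"
    by (rule bounded_operator_diff[OF bounded_operator_id[OF sX] bounded_operator_projection])
  have T1_op: "bounded_operator sX (module_prod.scale sX sZ) T1"
    unfolding T1_def
    by (intro bounded_operator_Pair sX sYZ bounded_operator_add R_op
        bounded_operator_functional_series sum_d sum_z)
  have fst_op: "bounded_operator (module_prod.scale sX sZ) sX fst"
    by (rule bounded_operator_fst[OF sX sYZ(2)])
  have T2_comp: "compact_operator (module_prod.scale sX sZ) sY T2"
    unfolding T2_def
    by (rule compact_operator_add_functional_series[OF banach_space_over_prod[OF sX sYZ(2)] sYZ(1) T
          bounded_operator_compose[OF R_op fst_op] fst_op sum_y])

  have D_eq: "?D x = (\<Sum>k. sX (of_real (\<mu> k) * f k x) (d k))"
    and D_summable: "summable (\<lambda>k. sX (of_real (\<mu> k) * f k x) (d k))" for x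
    using summable_functional_series[OF sX sum_d, of x]
    by (simp_all add: functional_series_def mult.commute flip: scale_of_real)
  have f_projection: "f k (projection x) = f k x" for k x
    unfolding functional_series_def by (rule f_of_series[OF summable_expansion])
  have f_D: "f k (?D x) = of_real (\<mu> k) * f k x" for k x
    unfolding D_eq by (rule f_of_series[OF D_summable])
  have f_T1: "f k (?R x + ?D x) = of_real (\<mu> k) * f k x" for k x
    by (simp add: f_add f_D f_projection linear_diff[OF bounded_linear.linear[OF bounded_linear_f]])

  have "T2 (T1 x) = T x" for x
  proof -
    have series_T1: "functional_series s v (?R x + ?D x) = (\<Sum>k. s (of_real (\<mu> k) * f k x) (v k))"
      for s :: "'k \<Rightarrow> 'b::banach \<Rightarrow> 'b" and v
      unfolding functional_series_def[of s v "?R x + ?D x"] f_T1 ..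
    have "projection (?R x + ?D x) = ?D x" unfolding series_T1 by (rule D_eq[symmetric])
    then have "?R (?R x + ?D x) = ?R x" by simp
    moreover have "functional_series sY ?y (?R x + ?D x) = T (projection x)"
    proof -
      have "sY (of_real (\<mu> k) * f k x) (?y k) = T (sX (f k x) (d k))" for k
        using \<mu>[of k]
        by (simp add: T_scale T.scaleR mult.commute flip: Y.scale_of_real)
      then have "functional_series sY ?y (?R x + ?D x) = (\<Sum>k. T (sX (f k x) (d k)))"
        unfolding series_T1 by (simp only:)
      also have "\<dots> = T (projection x)"
        unfolding functional_series_def by (rule T.suminf[OF summable_expansion, symmetric])
      finally show ?thesis .
    qed
    ultimately show ?thesis by (simp add: T2_def T1_def T.diff)
  qed
  then have T_eq: "T = T2 \<circ> T1" by auto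

  define V where "V = closure (range T1)"
  interpret T1: bounded_linear T1 using T1_op by (simp add: bounded_operator_def)
  have V: "real_vector.subspace V"
    unfolding V_def
    by (rule subspace_closure[OF linear_subspace_image[OF T1.linear real_vector.subspace_UNIV]])
  have T1_V: "T1 x \<in> V" for x unfolding V_def by (rule subsetD[OF closure_subset rangeI])
  have lim_V: "p \<in> V" if "\<And>n. q n \<in> V" "q \<longlonglongrightarrow> p" for q p
    using that closed_sequentially[of V q p] by (simp add: V_def)
  have T1_d: "T1 (sX c (d k)) = (\<mu> k *\<^sub>R sX c (d k), \<nu> k *\<^sub>R sZ c (z k))" for c k
    by (simp add: T1_def functional_series_d sX sYZ mult.commute flip: scale_of_real Z.scale_of_real)

  \<comment> \<open>Rescaled images of \<open>d k\<close>, for \<open>k\<close> running through the recurrences of \<open>w i\<close>, tend to \<open>(0,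
    w i)\<close>.\<close>
  have zero_w: "(0, w i) \<in> V" for i
  proof (rule lim_V)
    let ?k = "\<lambda>n. prod_encode (i, n)"
    have zk: "z (?k n) = w i" for n by (simp add: z_def)
    show "(1 / \<nu> (?k n)) *\<^sub>R T1 (sX 1 (d (?k n))) \<in> V" for n
      by (intro real_vector.subspace_scale[OF V] T1_V)
    have eq: "(1 / \<nu> (?k n)) *\<^sub>R T1 (sX 1 (d (?k n))) =
        (((1 / 2) ^ ?k n * (1 + norm (w i))) *\<^sub>R d (?k n), w i)" for n
    proof -
      have "\<mu> (?k n) / \<nu> (?k n) = (1 / 2) ^ ?k n * (1 + norm (w i))"
        by (simp add: \<mu>_def \<nu>_def zk power_one_over field_simps flip: power_mult_distrib)
      then show ?thesis using \<nu>[of "?k n"] by (simp add: T1_d[of 1, simplified] zk)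
    qed
    have "(\<lambda>n. ((1 / 2) ^ ?k n * (1 + norm (w i))) *\<^sub>R d (?k n)) \<longlonglongrightarrow> 0"
    proof (rule Lim_null_comparison)
      have "norm (((1 / 2) ^ ?k n * (1 + norm (w i))) *\<^sub>R d (?k n)) \<le>
          ((1 / 2) ^ n * (1 + norm (w i))) * 2" for n
      proof -
        have "(1 / 2 :: real) ^ ?k n \<le> (1 / 2) ^ n"
          by (rule power_decreasing) (auto intro: le_prod_encode_2)
        then show ?thesis
          unfolding norm_scaleR
          using z1[of "w i"] d_bound by (intro mult_mono) (auto simp: abs_mult intro: mult_right_mono)
      qed
      then show "\<forall>\<^sub>F n in sequentially. norm (((1 / 2) ^ ?k n * (1 + norm (w i))) *\<^sub>R d (?k n)) \<le>
          ((1 / 2) ^ n * (1 + norm (w i))) * 2" by simp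
      show "(\<lambda>n. ((1 / 2 :: real) ^ n * (1 + norm (w i))) * 2) \<longlonglongrightarrow> 0"
        by (intro tendsto_mult_left_zero LIMSEQ_power_zero) simp
    qed
    then show "(\<lambda>n. (1 / \<nu> (?k n)) *\<^sub>R T1 (sX 1 (d (?k n)))) \<longlonglongrightarrow> (0, w i)"
      unfolding eq by (intro tendsto_Pair tendsto_const)
  qed
  have zero_z: "(0, v) \<in> V" for v
  proof -
    have "v \<in> closure (range w)" using w by simp
    then obtain q where q: "\<And>n. q n \<in> range w" "q \<longlonglongrightarrow> v" by (auto simp: closure_sequential)
    show ?thesis
    proof (rule lim_V)
      show "(0, q n) \<in> V" for n using q(1)[of n] zero_w by auto
      show "(\<lambda>n. (0, q n)) \<longlonglongrightarrow> (0, v)" by (intro tendsto_Pair tendsto_const q(2))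
    qed
  qed
  have d_zero: "(sX c (d k), 0) \<in> V" for c k
  proof -
    have eq: "(sX c (d k), 0) = (1 / \<mu> k) *\<^sub>R (T1 (sX c (d k)) - (0, \<nu> k *\<^sub>R sZ c (z k)))"
      using \<mu>[of k] by (simp add: T1_d)
    show ?thesis
      unfolding eq
      by (intro real_vector.subspace_scale[OF V] real_vector.subspace_diff[OF V] T1_V zero_z)
  qed
  have series_zero: "(\<Sum>k. sX (c k) (d k), 0) \<in> V" if "summable (\<lambda>k. sX (c k) (d k))" for c
  proof (rule lim_V)
    have "(\<Sum>k<n. (sX (c k) (d k), 0 :: 'z)) \<in> V" for n
      by (intro real_vector.subspace_sum[OF V] d_zero)
    then show "(\<Sum>k<n. sX (c k) (d k), 0) \<in> V" for n
      by (simp add: sum_prod)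
    show "(\<lambda>n. (\<Sum>k<n. sX (c k) (d k), 0 :: 'z)) \<longlonglongrightarrow> (\<Sum>k. sX (c k) (d k), 0)"
      using that by (intro tendsto_Pair tendsto_const summable_LIMSEQ)
  qed
  have "(x, v) \<in> V" for x v
  proof -
    have proj_D: "(projection x, 0) \<in> V" "(?D x, 0) \<in> V"
      using series_zero[OF summable_expansion[of x]] series_zero[OF D_summable[of x]]
      by (simp_all only: D_eq functional_series_def[of sX d])
    have eq: "(x, v) = T1 x + (projection x, 0) - (?D x, 0) + (0, v - ?N x)"
      by (simp add: T1_def)
    show ?thesis
      unfolding eq
      by (intro real_vector.subspace_add[OF V] real_vector.subspace_diff[OF V] T1_V proj_D zero_z)
  qed
  then have "closure (range T1) = UNIV" unfolding V_def by auto
  with T1_op T2_comp T_eq show ?thesis by (intro exI conjI)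
qed

theorem theorem3p2:
  fixes sX :: "'k::real_or_complex \<Rightarrow> 'x::banach \<Rightarrow> 'x"
    and sY :: "'k \<Rightarrow> 'y::banach \<Rightarrow> 'y"
    and sZ :: "'k \<Rightarrow> 'z::banach \<Rightarrow> 'z"
    and T :: "'x \<Rightarrow> 'y"
  assumes "banach_space_over sX"
    and "banach_space_over sY"
    and "banach_space_over sZ"
    and "compact_operator sX sY T"
    and "\<exists>e. complemented_unconditional_basic_sequence sX e"
    and "separable_space (euclidean :: 'z topology)"
  shows "\<exists>(T1 :: 'x \<Rightarrow> 'x \<times> 'z) (T2 :: 'x \<times> 'z \<Rightarrow> 'y).
           bounded_operator sX (module_prod.scale sX sZ) T1 \<and>
           bounded_operator (module_prod.scale sX sZ) sY T2 \<and>
           T = T2 \<circ> T1 \<and>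
           closure (range T1) = UNIV \<and>
           compact_operator (module_prod.scale sX sZ) sY T2"
proof -
  obtain e where e: "complemented_unconditional_basic_sequence sX e" using assms(5) by blast
  have T: "bounded_linear T" "compact (closure (T ` cball 0 1))"
    using assms(4) by (simp_all add: compact_operator_def bounded_operator_def)
  obtain f C d where sys: "biorthogonal_system sX f C d" and Td: "\<And>k. norm (T (d k)) \<le> (1 / 8) ^ k"
    by (rule banach_space_over.nearly_annihilated_biorthogonal_system[OF assms(1) e T, of "\<lambda>k. (1 / 8) ^ k"])
      auto
  obtain W :: "'z set" where W: "countable W" "closure W = UNIV"
    using assms(6) by (auto simp: separable_space_def)
  then have "W \<noteq> {}" by auto
  then have "closure (range (from_nat_into W)) = UNIV"
    using W by (simp add: range_from_nat_into)
  from dense_compact_factorization[OF assms(2,3,4) sys Td this]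
  obtain T1 :: "'x \<Rightarrow> 'x \<times> 'z" and T2
    where T1: "bounded_operator sX (module_prod.scale sX sZ) T1"
      and T2: "compact_operator (module_prod.scale sX sZ) sY T2"
      and "T = T2 \<circ> T1" "closure (range T1) = UNIV"
    by (elim exE conjE)
  moreover have "bounded_operator (module_prod.scale sX sZ) sY T2"
    using T2 by (simp add: compact_operator_def)
  ultimately show ?thesis by (intro exI conjI)
qed

end
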